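(* The groups and pro-groups $\Gamma^{\mathrm{pro}}$, $\Gamma$, $\Gamma^{\mathrm{pro}}_+$ and $\Gamma_+$ associated to an aperiodic tiling $T$ of $\mathbb{R}^d$ ($d\geqslant 2$) with point group are S-MLD invariants of $T$.
   Context: A tiling of $\mathbb{R}^d$ is a cover of $\mathbb{R}^d$ by compact $d$-dimensional polyhedral subsets (tiles), possibly labelled, meeting full face to full face and only on boundaries, each tile being a translate (with matching label) of one of a finite set of prototiles; tilings are assumed to have finite local complexity (finitely many $r$-patches up to translation for each $r$, the $r$-patch at $x$ being the set of tiles meeting the closed ball of radius $r$ at $x$). A patch is a finite set of tiles. A tiling is aperiodic if it is not periodic. Isometries act on tilings and patches tile by tile. $\Omega_t$ is the space of tilings all of whose patches appear in $T$ up to translation, with the topology in which two tilings are close if they agree on a large ball about the origin after a small translation followed by a small rotation of either. A finite $G\leq\mathrm{SO}(d)$ acts on $T$ by rotations if for every patch $P$ of $T$ and $g\in G$, $g(P)$ is a patch of $T$ up to translation. $T$ has point group $G$ if moreover there is $r>0$ such that whenever an $r$-patch $P$ and $g(P)$, $g\in\mathrm{SO}(d)$, both occur in $T$ up to translation, then $g\in G$. $G_\pm\leq\mathrm{O}(d)$ is the extension of $G$ that includes, where relevant, the reflections (orientation reversing elements of $\mathrm{O}(d)$) which act on $T$ in the analogous sense. These groups act on $\Omega_t$ by $g\cdot T'=g(T')$. For $H=G$ or $G_\pm$ put $\Omega_H=(\Omega_t\times EH)/H$ (Borel construction, diagonal action, $EH$ a contractible free $H$-space), based at the class of $T$ together with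 an arbitrary base point of $EH$. A pro-group is an inverse sequence of groups $G_0\leftarrow G_1\leftarrow\cdots$. A morphism $G_*\to H_*$ is a sequence of homomorphisms $G_i\to H_{j(i)}$, with $j(i)$ increasing monotonically and $j(i)\to\infty$, commuting with structure maps; two pro-groups are pro-equivalent if there are morphisms both ways whose composites are equal to structure maps. The pro-homotopy group $\pi_k^{\mathrm{pro}}(X,x)$ of a pointed space is the pro-group obtained by applying $\pi_k$ to an expansion of $X$ (in the sense of shape theory) by an inverse sequence of pointed CW complexes; it is well defined up to pro-equivalence. For $\Omega_H$ one may use $(K_n\times EH)/H$, where $K_n=\Omega_t/\!\sim_n$ and $T'\sim_nT''$ iff $T',T''$ agree on the closed ball of radius $n$ about the origin. Then $\Gamma^{\mathrm{pro}}=\pi_1^{\mathrm{pro}}(\Omega_{G_\pm},T)$ (topological space pro-group), $\Gamma=\varprojlim\pi_1(\Omega_{G_\pm},T)$ (topological space group), $\Gamma^{\mathrm{pro}}_+=\pi_1^{\mathrm{pro}}(\Omega_G,T)$ and $\Gamma_+=\varprojlim\pi_1(\Omega_G,T)$ (their positive versions), the inverse limits being those of the corresponding pro-groups. $T_2$ is S-locally derivable from $T_1$ if there is $r>0$ such that whenever a rigid motion (orientation preserving isometry of $\mathbb{R}^d$) $\Phi$ identifies the $r$-patch at $x$ of $T_1$ with that at $\Phi(x)$, then $\Phi$ also identifies the $1$-patch at $x$ of $T_2$ with that at $\Phi(x)$. $T_1$, $T_2$ are S-MLD if each is S-locally derivable from the other. That an object is an S-MLD invariant means that S-MLD tilings have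 isomorphic such objects (as groups for $\Gamma$, $\Gamma_+$; up to pro-equivalence for $\Gamma^{\mathrm{pro}}$, $\Gamma^{\mathrm{pro}}_+$).
   Formalization: For Γ^pro and Γ, the local derivations must also respect the reflections in G_±, since plain S-MLD does not preserve these (a chiral subdivision is a counterexample); morphisms of pro-groups need homomorphisms G_i→H_{j(i)} only for all but finitely many i. *)

theory Defs
  imports "HOL-Analysis.Analysis" "HOL-Algebra.Group"
begin

section \<open>Tilings\<close>

text \<open>Unlabelled tilings are those with label type \<^typ>\<open>unit\<close>.\<close>

type_synonym ('n, 'l) tile = "(real ^ 'n) set \<times> 'l"
type_synonym ('n, 'l) tiling = "('n, 'l) tile set"
type_synonym 'n motion = "real ^ 'n \<Rightarrow> real ^ 'n"

definition move :: "'n::finite motion \<Rightarrow> ('n, 'l) tile set \<Rightarrow> ('n, 'l) tile set" where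
  "move \<Phi> P = (\<lambda>(S, l). (\<Phi> ` S, l)) ` P"

definition appears_in :: "('n::finite, 'l) tile set \<Rightarrow> ('n, 'l) tiling \<Rightarrow> bool" where
  "appears_in P T \<longleftrightarrow> (\<exists>v. move ((+) v) P \<subseteq> T)"

definition r_patch :: "('n::finite, 'l) tiling \<Rightarrow> real ^ 'n \<Rightarrow> real \<Rightarrow> ('n, 'l) tile set" where
  "r_patch T x r = {t \<in> T. fst t \<inter> cball x r \<noteq> {}}"

definition polyhedral_body :: "(real ^ 'n::finite) set \<Rightarrow> bool" where
  "polyhedral_body S \<longleftrightarrow> (\<exists>\<P>. finite \<P> \<and> \<P> \<noteq> {} \<and> S = \<Union>\<P> \<and>
     (\<forall>C\<in>\<P>. polytope C \<and> interior C \<noteq> {}))"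

text \<open>Tiles need not be convex. The faces of a polyhedral set are the closures of the connected
  components of the sets of points at which it has the same germ; for a convex polytope these
  are its nonempty faces in the sense of \<^const>\<open>face_of\<close>.\<close>

definition same_germ :: "(real ^ 'n::finite) set \<Rightarrow> real ^ 'n \<Rightarrow> real ^ 'n \<Rightarrow> bool" where
  "same_germ S x y \<longleftrightarrow> (\<exists>\<epsilon>>0. \<forall>v. norm v < \<epsilon> \<longrightarrow> (x + v \<in> S \<longleftrightarrow> y + v \<in> S))"

definition faces :: "(real ^ 'n::finite) set \<Rightarrow> (real ^ 'n) set set" where
  "faces S = {closure (connected_component_set {y \<in> S. same_germ S x y} x) | x. x \<in> S}"

definition is_tiling :: "('n::finite, 'l) tiling \<Rightarrow> bool" where
  "is_tiling T \<longleftrightarrow>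
     (\<forall>t\<in>T. polyhedral_body (fst t)) \<and>
     (\<Union>t\<in>T. fst t) = UNIV \<and>
     (\<forall>s\<in>T. \<forall>t\<in>T. s \<noteq> t \<longrightarrow>
        fst s \<inter> fst t \<subseteq> frontier (fst s) \<inter> frontier (fst t) \<and>
        fst s \<inter> fst t = \<Union>(faces (fst s) \<inter> faces (fst t))) \<and>
     (\<exists>prototiles. finite prototiles \<and> (\<forall>t\<in>T. \<exists>p\<in>prototiles. \<exists>v. {t} = move ((+) v) {p})) \<and>
     (\<forall>r. \<exists>\<Q>. finite \<Q> \<and> (\<forall>x. \<exists>Q\<in>\<Q>. \<exists>v. r_patch T x r = move ((+) v) Q))"

definition periodic :: "('n::finite, 'l) tiling \<Rightarrow> bool" where
  "periodic T \<longleftrightarrow> (\<exists>v. v \<noteq> 0 \<and> move ((+) v) T = T)"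

section \<open>Rotations, reflections and the point group\<close>

definition orthogonal_maps :: "'n::finite motion set" where
  "orthogonal_maps = {g. orthogonal_transformation g}"

definition rotations :: "'n::finite motion set" where
  "rotations = {g \<in> orthogonal_maps. det (matrix g) = 1}"

definition orthogonal_group :: "'n::finite motion monoid" where
  "orthogonal_group = \<lparr>carrier = orthogonal_maps, mult = (\<circ>), one = id\<rparr>"

definition acts_on :: "'n::finite motion \<Rightarrow> ('n, 'l) tiling \<Rightarrow> bool" where
  "acts_on g T \<longleftrightarrow> (\<forall>P. finite P \<and> P \<subseteq> T \<longrightarrow> appears_in (move g P) T)"

definition has_point_group :: "('n::finite, 'l) tiling \<Rightarrow> 'n motion set \<Rightarrow> bool" where
  "has_point_group T G \<longleftrightarrow>
     finite G \<and> subgroup G orthogonal_group \<and> G \<subseteq> rotations \<and> (\<forall>g\<in>G. acts_on g T) \<and>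
     (\<exists>r>0. \<forall>x. \<forall>g\<in>rotations. appears_in (move g (r_patch T x r)) T \<longrightarrow> g \<in> G)"

definition G_pm :: "('n::finite, 'l) tiling \<Rightarrow> 'n motion set \<Rightarrow> 'n motion set" where
  "G_pm T G = G \<union> {g \<in> orthogonal_maps - rotations. acts_on g T}"

section \<open>The hull\<close>

definition tiling_hull :: "('n::finite, 'l) tiling \<Rightarrow> ('n, 'l) tiling set" where
  "tiling_hull T = {T'. is_tiling T' \<and> (\<forall>P. finite P \<and> P \<subseteq> T' \<longrightarrow> appears_in P T)}"

definition close_tilings :: "real \<Rightarrow> ('n::finite, 'l) tiling \<Rightarrow> ('n, 'l) tiling \<Rightarrow> bool" where
  "close_tilings \<epsilon> T' T'' \<longleftrightarrow> (\<exists>v w. \<exists>\<rho>\<in>rotations. \<exists>\<sigma>\<in>rotations.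
     norm v < \<epsilon> \<and> norm w < \<epsilon> \<and> onorm (\<lambda>x. \<rho> x - x) < \<epsilon> \<and> onorm (\<lambda>x. \<sigma> x - x) < \<epsilon> \<and>
     r_patch (move \<rho> (move ((+) v) T')) 0 (1 / \<epsilon>) = r_patch (move \<sigma> (move ((+) w) T'')) 0 (1 / \<epsilon>))"

definition hull_topology :: "('n::finite, 'l) tiling \<Rightarrow> ('n, 'l) tiling topology" where
  "hull_topology T = topology (\<lambda>U. U \<subseteq> tiling_hull T \<and>
     (\<forall>T'\<in>U. \<exists>\<epsilon>>0. \<forall>T''\<in>tiling_hull T. close_tilings \<epsilon> T' T'' \<longrightarrow> T'' \<in> U))"

lemma close_tilings_mono:
  fixes T' T'' :: "('n::finite, 'l) tiling"
  assumes "close_tilings \<epsilon> T' T''" "0 < \<epsilon>" "\<epsilon> \<le> \<delta>"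
  shows "close_tilings \<delta> T' T''"
proof -
  have *: "r_patch A 0 (1 / \<delta>) = r_patch B 0 (1 / \<delta>)"
    if "r_patch A 0 (1 / \<epsilon>) = r_patch B 0 (1 / \<epsilon>)" for A B :: "('n, 'l) tiling"
  proof -
    have "1 / \<delta> \<le> 1 / \<epsilon>" using assms(2,3) by (simp add: frac_le)
    then have sub: "cball (0 :: real ^ 'n) (1 / \<delta>) \<subseteq> cball 0 (1 / \<epsilon>)" by (rule subset_cball)
    have eq: "r_patch C 0 (1 / \<delta>) = {t \<in> r_patch C 0 (1 / \<epsilon>). fst t \<inter> cball 0 (1 / \<delta>) \<noteq> {}}"
      for C :: "('n, 'l) tiling"
      unfolding r_patch_def using sub by blast
    show ?thesis unfolding eq that ..
  qed
  obtain v w \<rho> \<sigma> where h: "\<rho> \<in> rotations" "\<sigma> \<in> rotations" "norm v < \<epsilon>" "norm w < \<epsilon>"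
    "onorm (\<lambda>x. \<rho> x - x) < \<epsilon>" "onorm (\<lambda>x. \<sigma> x - x) < \<epsilon>"
    "r_patch (move \<rho> (move ((+) v) T')) 0 (1 / \<epsilon>) = r_patch (move \<sigma> (move ((+) w) T'')) 0 (1 / \<epsilon>)"
    using assms(1) unfolding close_tilings_def by blast
  have "norm v < \<delta>" "norm w < \<delta>" "onorm (\<lambda>x. \<rho> x - x) < \<delta>" "onorm (\<lambda>x. \<sigma> x - x) < \<delta>"
    using h(3-6) assms(3) by linarith+
  with h(1,2) *[OF h(7)] show ?thesis
    unfolding close_tilings_def by blast
qed

lemma istopology_neighbourhoods:
  fixes C :: "real \<Rightarrow> 'a \<Rightarrow> 'a \<Rightarrow> bool"
  assumes mono: "\<And>d e x y. C d x y \<Longrightarrow> 0 < d \<Longrightarrow> d \<le> e \<Longrightarrow> C e x y"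
  shows "istopology (\<lambda>U. U \<subseteq> S \<and> (\<forall>x\<in>U. \<exists>e>0. \<forall>y\<in>S. C e x y \<longrightarrow> y \<in> U))"
    (is "istopology ?op")
proof -
  have "?op (U \<inter> V)" if U: "?op U" and V: "?op V" for U V
  proof (intro conjI ballI)
    show "U \<inter> V \<subseteq> S" using U by blast
    fix x assume x: "x \<in> U \<inter> V"
    obtain a where a: "a > 0" "\<forall>y\<in>S. C a x y \<longrightarrow> y \<in> U" using U x by blast
    obtain b where b: "b > 0" "\<forall>y\<in>S. C b x y \<longrightarrow> y \<in> V" using V x by blast
    have "min a b > 0" using a(1) b(1) by simp
    moreover have "y \<in> U \<inter> V" if "y \<in> S" "C (min a b) x y" for y
      using mono[OF that(2) \<open>min a b > 0\<close>] a(2) b(2) that(1) by (meson IntI min.cobounded1 min.cobounded2)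
    ultimately show "\<exists>e>0. \<forall>y\<in>S. C e x y \<longrightarrow> y \<in> U \<inter> V" by blast
  qed
  moreover have "?op (\<Union>\<K>)" if K: "\<forall>U\<in>\<K>. ?op U" for \<K>
  proof (intro conjI ballI)
    show "\<Union>\<K> \<subseteq> S" using K by blast
    fix x assume "x \<in> \<Union>\<K>"
    then obtain U where U: "U \<in> \<K>" "x \<in> U" by blast
    then obtain e where "e > 0" "\<forall>y\<in>S. C e x y \<longrightarrow> y \<in> U" using K by blast
    with U(1) show "\<exists>e>0. \<forall>y\<in>S. C e x y \<longrightarrow> y \<in> \<Union>\<K>" by blast
  qed
  ultimately show ?thesis unfolding istopology_def by (rule conjI[OF allI[OF allI[OF impI[OF impI]]] allI[OF impI]])
qed

lemma openin_hull_topology: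
  "openin (hull_topology T) U \<longleftrightarrow> U \<subseteq> tiling_hull T \<and>
     (\<forall>T'\<in>U. \<exists>\<epsilon>>0. \<forall>T''\<in>tiling_hull T. close_tilings \<epsilon> T' T'' \<longrightarrow> T'' \<in> U)"
  unfolding hull_topology_def
  by (rule topology_inverse'[THEN fun_cong])
    (rule istopology_neighbourhoods[where C = close_tilings], rule close_tilings_mono)

lemma topspace_hull_topology: "topspace (hull_topology T) = tiling_hull T"
proof -
  have "openin (hull_topology T) (tiling_hull T)"
    unfolding openin_hull_topology using zero_less_one by blast
  moreover have "topspace (hull_topology T) \<subseteq> tiling_hull T"
    using openin_topspace[of "hull_topology T"] unfolding openin_hull_topology by (rule conjunct1)
  ultimately show ?thesis
    by (intro subset_antisym openin_subset)
qed

section \<open>Borel constructions\<close>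

definition identification_topology :: "'a topology \<Rightarrow> ('a \<Rightarrow> 'b) \<Rightarrow> 'b topology" where
  "identification_topology X q =
     topology (\<lambda>U. U \<subseteq> q ` topspace X \<and> openin X {x \<in> topspace X. q x \<in> U})"

lemma openin_identification_topology:
  "openin (identification_topology X q) U \<longleftrightarrow>
     U \<subseteq> q ` topspace X \<and> openin X {x \<in> topspace X. q x \<in> U}"
proof -
  let ?op = "\<lambda>U. U \<subseteq> q ` topspace X \<and> openin X {x \<in> topspace X. q x \<in> U}"
  have "?op (U \<inter> V)" if U: "?op U" and V: "?op V" for U V
  proof
    show "U \<inter> V \<subseteq> q ` topspace X" using U by blast
    have "{x \<in> topspace X. q x \<in> U \<inter> V} = {x \<in> topspace X. q x \<in> U} \<inter> {x \<in> topspace X. q x \<in> V}"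
      by blast
    moreover have "openin X ({x \<in> topspace X. q x \<in> U} \<inter> {x \<in> topspace X. q x \<in> V})"
      using conjunct2[OF U] conjunct2[OF V] by (rule openin_Int)
    ultimately show "openin X {x \<in> topspace X. q x \<in> U \<inter> V}" by (simp only:)
  qed
  moreover have "?op (\<Union>\<K>)" if K: "\<forall>U\<in>\<K>. ?op U" for \<K>
  proof
    show "\<Union>\<K> \<subseteq> q ` topspace X" using K by blast
    have "{x \<in> topspace X. q x \<in> \<Union>\<K>} = \<Union>((\<lambda>U. {x \<in> topspace X. q x \<in> U}) ` \<K>)" by blast
    moreover have "openin X (\<Union>((\<lambda>U. {x \<in> topspace X. q x \<in> U}) ` \<K>))"
      by (rule openin_Union) (use K in blast)
    ultimately show "openin X {x \<in> topspace X. q x \<in> \<Union>\<K>}" by (simp only:)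
  qed
  ultimately have "istopology ?op"
    unfolding istopology_def by (rule conjI[OF allI[OF allI[OF impI[OF impI]]] allI[OF impI]])
  from topology_inverse'[OF this] show ?thesis unfolding identification_topology_def by (rule fun_cong)
qed

lemma quotient_map_identification_topology: "quotient_map X (identification_topology X q) q"
proof -
  have "{x \<in> topspace X. q x \<in> q ` topspace X} = topspace X" by blast
  then have "openin (identification_topology X q) (q ` topspace X)"
    unfolding openin_identification_topology by simp
  moreover have "topspace (identification_topology X q) \<subseteq> q ` topspace X"
    using openin_topspace[of "identification_topology X q"]
    unfolding openin_identification_topology by (rule conjunct1)
  ultimately have "topspace (identification_topology X q) = q ` topspace X"
    by (intro subset_antisym openin_subset)
  then show ?thesis
    unfolding quotient_map_def openin_identification_topology by blast
qed

record ('n, 'e) pointed_action_space =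
  space_of :: "'e topology"
  action :: "'n motion \<Rightarrow> 'e \<Rightarrow> 'e"
  base :: 'e

definition contractible_free_space ::
  "'n::finite motion set \<Rightarrow> ('n, 'e) pointed_action_space \<Rightarrow> bool" where
  "contractible_free_space H E \<longleftrightarrow>
     contractible_space (space_of E) \<and> base E \<in> topspace (space_of E) \<and>
     (\<forall>h\<in>H. continuous_map (space_of E) (space_of E) (action E h)) \<and>
     (\<forall>y\<in>topspace (space_of E). action E id y = y) \<and>
     (\<forall>g\<in>H. \<forall>h\<in>H. \<forall>y\<in>topspace (space_of E). action E (g \<circ> h) y = action E g (action E h y)) \<and>
     (\<forall>h\<in>H. \<forall>y\<in>topspace (space_of E). action E h y = y \<longrightarrow> h = id)"

definition diagonal_orbit ::
  "'n::finite motion set \<Rightarrow> ('n motion \<Rightarrow> 'y \<Rightarrow> 'y) \<Rightarrow> ('n, 'e) pointed_action_space \<Rightarrow>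
   'y \<times> 'e \<Rightarrow> ('y \<times> 'e) set" where
  "diagonal_orbit H a E p = (\<lambda>h. (a h (fst p), action E h (snd p))) ` H"

definition borel_construction ::
  "'n::finite motion set \<Rightarrow> 'y topology \<Rightarrow> ('n motion \<Rightarrow> 'y \<Rightarrow> 'y) \<Rightarrow>
   ('n, 'e) pointed_action_space \<Rightarrow> ('y \<times> 'e) set topology" where
  "borel_construction H Y a E =
     identification_topology (prod_topology Y (space_of E)) (diagonal_orbit H a E)"

definition Omega ::
  "'n::finite motion set \<Rightarrow> ('n, 'e) pointed_action_space \<Rightarrow> ('n, 'l) tiling \<Rightarrow>
   (('n, 'l) tiling \<times> 'e) set topology" where
  "Omega H E T = borel_construction H (hull_topology T) move E"

definition Omega_base ::
  "'n::finite motion set \<Rightarrow> ('n, 'e) pointed_action_space \<Rightarrow> ('n, 'l) tiling \<Rightarrow>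
   (('n, 'l) tiling \<times> 'e) set" where
  "Omega_base H E T = diagonal_orbit H move E (T, base E)"

section \<open>Pro-groups\<close>

text \<open>An inverse sequence \<open>(G, p)\<close> has bonding maps \<open>p i : G (Suc i) \<rightarrow> G i\<close>, and
  \<open>structure_map p i k\<close> is the composite \<open>G i \<rightarrow> G k\<close> for \<open>k \<le> i\<close>.\<close>

type_synonym 'g pro_group = "(nat \<Rightarrow> 'g monoid) \<times> (nat \<Rightarrow> 'g \<Rightarrow> 'g)"

primrec composite_down :: "(nat \<Rightarrow> 'g \<Rightarrow> 'g) \<Rightarrow> nat \<Rightarrow> nat \<Rightarrow> 'g \<Rightarrow> 'g" where
  "composite_down p k 0 = id"
| "composite_down p k (Suc m) = composite_down p k m \<circ> p (k + m)"

definition structure_map :: "(nat \<Rightarrow> 'g \<Rightarrow> 'g) \<Rightarrow> nat \<Rightarrow> nat \<Rightarrow> 'g \<Rightarrow> 'g" where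
  "structure_map p i k = composite_down p k (i - k)"

text \<open>The homomorphisms \<open>f i : G i \<rightarrow> H (j i)\<close> are required for all but finitely many \<open>i\<close> (those
  with \<open>i \<ge> N\<close>). Requiring them for every \<open>i\<close> would distinguish the sequence \<open>1 \<leftarrow> G \<leftarrow> G \<leftarrow> \<dots>\<close> from
  the constant sequence \<open>G\<close>, although both come from expansions of the same space.\<close>

definition pro_morphism ::
  "'g pro_group \<Rightarrow> 'h pro_group \<Rightarrow> nat \<Rightarrow> (nat \<Rightarrow> nat) \<Rightarrow> (nat \<Rightarrow> 'g \<Rightarrow> 'h) \<Rightarrow> bool" where
  "pro_morphism P Q N j f \<longleftrightarrow>
     mono j \<and> filterlim j at_top at_top \<and>
     (\<forall>i\<ge>N. f i \<in> hom (fst P i) (fst Q (j i))) \<and>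
     (\<forall>i\<ge>N. \<forall>i'\<ge>i. \<forall>x\<in>carrier (fst P i').
        f i (structure_map (snd P) i' i x) = structure_map (snd Q) (j i') (j i) (f i' x))"

definition composes_to_structure_maps ::
  "'g pro_group \<Rightarrow> nat \<Rightarrow> (nat \<Rightarrow> nat) \<Rightarrow> (nat \<Rightarrow> 'g \<Rightarrow> 'h) \<Rightarrow>
   nat \<Rightarrow> (nat \<Rightarrow> nat) \<Rightarrow> (nat \<Rightarrow> 'h \<Rightarrow> 'g) \<Rightarrow> bool" where
  "composes_to_structure_maps P N j f M k g \<longleftrightarrow>
     (\<forall>i\<ge>N. j i \<ge> M \<longrightarrow> k (j i) \<le> i \<and>
        (\<forall>x\<in>carrier (fst P i). g (j i) (f i x) = structure_map (snd P) i (k (j i)) x))"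

definition pro_equivalent :: "'g pro_group \<Rightarrow> 'h pro_group \<Rightarrow> bool" where
  "pro_equivalent P Q \<longleftrightarrow> (\<exists>N j f M k g.
     pro_morphism P Q N j f \<and> pro_morphism Q P M k g \<and>
     composes_to_structure_maps P N j f M k g \<and> composes_to_structure_maps Q M k g N j f)"

definition inverse_limit :: "'g pro_group \<Rightarrow> (nat \<Rightarrow> 'g) monoid" where
  "inverse_limit P =
     \<lparr>carrier = {s. \<forall>i. s i \<in> carrier (fst P i) \<and> snd P i (s (Suc i)) = s i},
      mult = (\<lambda>s t i. s i \<otimes>\<^bsub>fst P i\<^esub> t i),
      one = (\<lambda>i. \<one>\<^bsub>fst P i\<^esub>)\<rparr>"

section \<open>The fundamental group of an abstract topological space\<close>

definition loops :: "'x topology \<Rightarrow> 'x \<Rightarrow> (real \<Rightarrow> 'x) set" where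
  "loops X x = {p. pathin X p \<and> p 0 = x \<and> p 1 = x}"

definition loop_class :: "'x topology \<Rightarrow> 'x \<Rightarrow> (real \<Rightarrow> 'x) \<Rightarrow> (real \<Rightarrow> 'x) set" where
  "loop_class X x p = {q \<in> loops X x.
     homotopic_with (\<lambda>l. l 0 = x \<and> l 1 = x) (top_of_set {0..1}) X p q}"

definition concat_loops :: "(real \<Rightarrow> 'x) \<Rightarrow> (real \<Rightarrow> 'x) \<Rightarrow> real \<Rightarrow> 'x" where
  "concat_loops p q = (\<lambda>t. if t \<le> 1 / 2 then p (2 * t) else q (2 * t - 1))"

definition pi1 :: "'x topology \<Rightarrow> 'x \<Rightarrow> (real \<Rightarrow> 'x) set monoid" where
  "pi1 X x =
     \<lparr>carrier = loop_class X x ` loops X x,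
      mult = (\<lambda>A B. \<Union>p\<in>A. \<Union>q\<in>B. loop_class X x (concat_loops p q)),
      one = loop_class X x (\<lambda>_. x)\<rparr>"

definition pi1_map :: "'y topology \<Rightarrow> 'y \<Rightarrow> ('x \<Rightarrow> 'y) \<Rightarrow> (real \<Rightarrow> 'x) set \<Rightarrow> (real \<Rightarrow> 'y) set" where
  "pi1_map Y y f A = (\<Union>p\<in>A. loop_class Y y (f \<circ> p))"

definition pi1_sequence ::
  "(nat \<Rightarrow> 'x topology) \<Rightarrow> (nat \<Rightarrow> 'x) \<Rightarrow> (nat \<Rightarrow> 'x \<Rightarrow> 'x) \<Rightarrow> (real \<Rightarrow> 'x) set pro_group" where
  "pi1_sequence X x b = ((\<lambda>i. pi1 (X i) (x i)), (\<lambda>i. pi1_map (X i) (x i) (b i)))"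

section \<open>CW complexes, expansions and pro-fundamental groups\<close>

definition disc :: "nat \<Rightarrow> (nat \<Rightarrow> real) set" where
  "disc n = {x \<in> topspace (Euclidean_space n). (\<Sum>i<n. (x i)\<^sup>2) \<le> 1}"

definition open_disc :: "nat \<Rightarrow> (nat \<Rightarrow> real) set" where
  "open_disc n = {x \<in> topspace (Euclidean_space n). (\<Sum>i<n. (x i)\<^sup>2) < 1}"

definition cw_complex :: "'x topology \<Rightarrow> bool" where
  "cw_complex X \<longleftrightarrow> Hausdorff_space X \<and>
     (\<exists>(\<C> :: 'x set set) (dimn :: 'x set \<Rightarrow> nat) (\<phi> :: 'x set \<Rightarrow> (nat \<Rightarrow> real) \<Rightarrow> 'x).
        disjoint \<C> \<and> \<Union>\<C> = topspace X \<and>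
        (\<forall>c\<in>\<C>.
           continuous_map (subtopology (Euclidean_space (dimn c)) (disc (dimn c))) X (\<phi> c) \<and>
           homeomorphic_map (subtopology (Euclidean_space (dimn c)) (open_disc (dimn c)))
             (subtopology X c) (\<phi> c) \<and>
           (\<exists>\<F>. finite \<F> \<and> \<F> \<subseteq> {c'\<in>\<C>. dimn c' < dimn c} \<and>
              \<phi> c ` (disc (dimn c) - open_disc (dimn c)) \<subseteq> \<Union>\<F>)) \<and>
        (\<forall>A. A \<subseteq> topspace X \<longrightarrow>
           (closedin X A \<longleftrightarrow> (\<forall>c\<in>\<C>. closedin X (A \<inter> (X closure_of c))))))"

definition pointed_map :: "'x topology \<Rightarrow> 'x \<Rightarrow> 'y topology \<Rightarrow> 'y \<Rightarrow> ('x \<Rightarrow> 'y) \<Rightarrow> bool" where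
  "pointed_map X x Y y f \<longleftrightarrow> continuous_map X Y f \<and> f x = y"

definition pointed_homotopic ::
  "'x topology \<Rightarrow> 'x \<Rightarrow> 'y topology \<Rightarrow> 'y \<Rightarrow> ('x \<Rightarrow> 'y) \<Rightarrow> ('x \<Rightarrow> 'y) \<Rightarrow> bool" where
  "pointed_homotopic X x Y y = homotopic_with (\<lambda>h. h x = y) X Y"

text \<open>An expansion in the sense of shape theory. The type \<open>'u\<close> of the points of the \<open>X i\<close> also
  bounds the size of the CW complexes \<open>P\<close> that are used for testing.\<close>

definition cw_expansion ::
  "'x topology \<Rightarrow> 'x \<Rightarrow> (nat \<Rightarrow> 'u topology) \<Rightarrow> (nat \<Rightarrow> 'u) \<Rightarrow> (nat \<Rightarrow> 'u \<Rightarrow> 'u) \<Rightarrow>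
   (nat \<Rightarrow> 'x \<Rightarrow> 'u) \<Rightarrow> bool" where
  "cw_expansion X x Xs xs b p \<longleftrightarrow>
     (\<forall>i. cw_complex (Xs i) \<and> xs i \<in> topspace (Xs i) \<and>
        pointed_map (Xs (Suc i)) (xs (Suc i)) (Xs i) (xs i) (b i) \<and>
        pointed_map X x (Xs i) (xs i) (p i) \<and>
        pointed_homotopic X x (Xs i) (xs i) (b i \<circ> p (Suc i)) (p i)) \<and>
     (\<forall>(P :: 'u topology) y f. cw_complex P \<and> y \<in> topspace P \<and> pointed_map X x P y f \<longrightarrow>
        (\<exists>i g. pointed_map (Xs i) (xs i) P y g \<and> pointed_homotopic X x P y (g \<circ> p i) f)) \<and>
     (\<forall>(P :: 'u topology) y i g h. cw_complex P \<and> y \<in> topspace P \<and>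
        pointed_map (Xs i) (xs i) P y g \<and> pointed_map (Xs i) (xs i) P y h \<and>
        pointed_homotopic X x P y (g \<circ> p i) (h \<circ> p i) \<longrightarrow>
        (\<exists>i'\<ge>i. pointed_homotopic (Xs i') (xs i') P y
           (g \<circ> structure_map b i' i) (h \<circ> structure_map b i' i)))"

definition is_pro_pi1 :: "'x topology \<Rightarrow> 'x \<Rightarrow> (real \<Rightarrow> 'u) set pro_group \<Rightarrow> bool" where
  "is_pro_pi1 X x P \<longleftrightarrow> (\<exists>Xs xs b p. cw_expansion X x Xs xs b p \<and> P = pi1_sequence Xs xs b)"

section \<open>The approximants\<close>

text \<open>The quotients \<open>\<Omega>\<^sub>t/\<sim>\<^sub>n\<close>, and the inverse sequence of the groups
  \<open>\<pi>\<^sub>1((K\<^sub>n \<times> EH)/H)\<close> with \<open>K\<^sub>n = approximant T n\<close>.\<close>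

definition agreement_class :: "('n::finite, 'l) tiling \<Rightarrow> nat \<Rightarrow> ('n, 'l) tiling \<Rightarrow> ('n, 'l) tiling set" where
  "agreement_class T n T' = {T'' \<in> tiling_hull T. r_patch T'' 0 (real n) = r_patch T' 0 (real n)}"

definition approximant :: "('n::finite, 'l) tiling \<Rightarrow> nat \<Rightarrow> ('n, 'l) tiling set topology" where
  "approximant T n = identification_topology (hull_topology T) (agreement_class T n)"

definition approximant_pro_pi1 ::
  "'n::finite motion set \<Rightarrow> ('n, 'e) pointed_action_space \<Rightarrow> ('n, 'l) tiling \<Rightarrow>
   (real \<Rightarrow> (('n, 'l) tiling set \<times> 'e) set) set pro_group" where
  "approximant_pro_pi1 H E T = pi1_sequence
     (\<lambda>n. borel_construction H (approximant T n) (\<lambda>g C. move g ` C) E)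
     (\<lambda>n. diagonal_orbit H (\<lambda>g C. move g ` C) E (agreement_class T n T, base E))
     (\<lambda>n O'. (\<lambda>(C, y). (\<Union>(agreement_class T n ` C), y)) ` O')"

section \<open>Local derivability\<close>

definition locally_derivable ::
  "'n::finite motion set \<Rightarrow> ('n, 'l) tiling \<Rightarrow> ('n, 'k) tiling \<Rightarrow> bool" where
  "locally_derivable A T1 T2 \<longleftrightarrow> (\<exists>r>0. \<forall>g\<in>A. \<forall>v x. let \<Phi> = (\<lambda>y. g y + v) in
     move \<Phi> (r_patch T1 x r) = r_patch T1 (\<Phi> x) r \<longrightarrow>
     move \<Phi> (r_patch T2 x 1) = r_patch T2 (\<Phi> x) 1)"

definition S_MLD :: "('n::finite, 'l) tiling \<Rightarrow> ('n, 'k) tiling \<Rightarrow> bool" where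
  "S_MLD T1 T2 \<longleftrightarrow> locally_derivable rotations T1 T2 \<and> locally_derivable rotations T2 T1"

text \<open>S-MLD where the local derivations must also respect those reflections which are relevant
  to \<open>G_pm\<close>. It coincides with \<open>S_MLD\<close> if no reflection acts on either tiling. Plain \<open>S_MLD\<close> does
  not determine \<open>G_pm\<close>: cutting the squares of a square tiling with one marked square by a
  chiral 4-fold symmetric pattern gives an S-MLD tiling on which no reflection acts.\<close>

definition S_MLD_pm ::
  "('n::finite, 'l) tiling \<Rightarrow> 'n motion set \<Rightarrow> ('n, 'k) tiling \<Rightarrow> 'n motion set \<Rightarrow> bool" where
  "S_MLD_pm T1 G1 T2 G2 \<longleftrightarrow>
     locally_derivable (rotations \<union> G_pm T1 G1) T1 T2 \<and>
     locally_derivable (rotations \<union> G_pm T2 G2) T2 T1"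

end

theory Submission
  imports Defs
begin

text \<open>
  Let \<open>T1\<close> and \<open>T2\<close> be S-MLD. The local derivation of \<open>T2\<close> from \<open>T1\<close> extends to the whole hull:
  every \<open>S\<close> in the hull of \<open>T1\<close> looks, on each ball, like a translate \<open>T1 + v\<close>, and the derived
  tiling of \<open>S\<close> is the tiling that looks like \<open>T2 + v\<close> on a ball whose radius is smaller by the
  derivation radius \<open>r\<close> (\<open>derived_agree\<close>). Since the derivation commutes with the rigid motions, the
  resulting map of hulls is continuous, commutes with the rotations and reflections that act, and
  sends \<open>T1\<close> to \<open>T2\<close>; the derivation in the other direction gives its inverse (\<open>derived_inverse\<close>).
  The group of rotations that act on a tiling, which is what a point group is, is therefore the same
  for \<open>T1\<close> and \<open>T2\<close>, and likewise for the extended group if the derivations also commute with the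
  reflections in it.

  It follows that the Borel constructions \<open>\<Omega>\<^sub>H\<close> of both tilings are homeomorphic by a pointed map, so
  that an expansion of one of them is also an expansion of the other. Two expansions of the same
  space are linked by a zigzag \<open>X (m 0) \<leftarrow> Y (n 0) \<leftarrow> X (m 1) \<leftarrow> Y (n 1) \<leftarrow> \<dots>\<close> of pointed maps between
  cofinal subsequences that commutes up to pointed homotopy (\<open>cw_expansions_interleave\<close>). For the
  approximants, a strictly commuting zigzag exists for another reason: tilings that agree on the ball
  of radius \<open>n + r\<close> have derived tilings that agree on the ball of radius \<open>n\<close>, so the map of hulls
  induces maps \<open>K\<^bsub>n + c\<^esub> \<rightarrow> K\<^sub>n\<close> from the approximants of \<open>T1\<close> to those of \<open>T2\<close>, for any natural
  number \<open>c \<ge> r\<close>, and similarly backwards.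

  In both cases the fundamental groups form a commutative zigzag of homomorphisms, and such an
  interleaving yields a pro-equivalence (\<open>interleaving_imp_pro_equivalent\<close>) as well as an isomorphism
  of the inverse limits (\<open>interleaving_imp_inverse_limit_iso\<close>).
\<close>

section \<open>Functoriality of the fundamental group\<close>

lemma loops_iff:
  "p \<in> loops X x \<longleftrightarrow> continuous_map (top_of_set {0..1}) X p \<and> p 0 = x \<and> p 1 = x"
  by (simp add: loops_def pathin_def)

text \<open>Homotopy of loops relative to the base point.\<close>

abbreviation loop_homotopic where
  "loop_homotopic X x \<equiv> homotopic_with (\<lambda>l. l 0 = x \<and> l 1 = x) (top_of_set {0..1}) X"

lemma loop_homotopic_imp_loops:
  assumes "loop_homotopic X x p q"
  shows "p \<in> loops X x" "q \<in> loops X x"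
  using homotopic_with_imp_continuous_maps[OF assms] homotopic_with_imp_property[OF assms]
  by (auto simp: loops_iff)

lemma loop_homotopic_refl: "p \<in> loops X x \<Longrightarrow> loop_homotopic X x p p"
  by (simp add: loops_iff)

lemma loop_class_eq:
  assumes "loop_homotopic X x p q"
  shows "loop_class X x p = loop_class X x q"
  unfolding loop_class_def
  using homotopic_with_trans[OF assms] homotopic_with_trans[OF homotopic_with_symD[OF assms]]
  by blast

lemma self_in_loop_class: "p \<in> loops X x \<Longrightarrow> p \<in> loop_class X x p"
  by (simp add: loop_class_def loops_iff)

lemma in_loop_classD: "q \<in> loop_class X x p \<Longrightarrow> loop_homotopic X x p q"
  by (simp add: loop_class_def)

lemma concat_homotopic:
  assumes "loop_homotopic X x p p'" "loop_homotopic X x q q'"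
  shows "loop_homotopic X x (concat_loops p q) (concat_loops p' q')"
proof -
  let ?I = "top_of_set {0..1::real}"
  let ?II = "prod_topology ?I ?I"
  obtain h where h: "continuous_map ?II X h" "\<And>s. h (0, s) = p s" "\<And>s. h (1, s) = p' s"
    "\<And>t. t \<in> {0..1} \<Longrightarrow> h (t, 0) = x \<and> h (t, 1) = x"
    using assms(1) unfolding homotopic_with_def by blast
  obtain k where k: "continuous_map ?II X k" "\<And>s. k (0, s) = q s" "\<And>s. k (1, s) = q' s"
    "\<And>t. t \<in> {0..1} \<Longrightarrow> k (t, 0) = x \<and> k (t, 1) = x"
    using assms(2) unfolding homotopic_with_def by blast
  define H where "H = (\<lambda>z. if snd z \<le> (1/2::real) then (h \<circ> (\<lambda>z. (fst z, 2 * snd z))) z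
    else (k \<circ> (\<lambda>z. (fst z, 2 * snd z - 1))) z)"
  have II: "?II = top_of_set ({0..1} \<times> {0..1})"
    by (simp add: prod_topology_subtopology subtopology_subtopology euclidean_product_topology Times_Int_Times)
  have "continuous_map ?II X H"
    unfolding H_def
  proof (rule continuous_map_cases_le)
    show "continuous_map ?II euclideanreal snd"
      by (simp add: II continuous_on_snd continuous_on_id)
    show "continuous_map (subtopology ?II {z \<in> topspace ?II. snd z \<le> 1/2}) X
        (h \<circ> (\<lambda>z. (fst z, 2 * snd z)))"
      by (rule continuous_map_compose[OF _ h(1)])
        (auto simp: II subtopology_subtopology intro!: continuous_intros)
    show "continuous_map (subtopology ?II {z \<in> topspace ?II. 1/2 \<le> snd z}) X
        (k \<circ> (\<lambda>z. (fst z, 2 * snd z - 1)))"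
      by (rule continuous_map_compose[OF _ k(1)])
        (auto simp: II subtopology_subtopology intro!: continuous_intros)
  next
    fix z assume z: "z \<in> topspace ?II" "snd z = 1/2"
    then have "2 * snd z = 1" "2 * snd z - 1 = 0" "fst z \<in> {0..1}" by (auto simp: II)
    then show "(h \<circ> (\<lambda>z. (fst z, 2 * snd z))) z = (k \<circ> (\<lambda>z. (fst z, 2 * snd z - 1))) z"
      by (simp only: comp_def h(4) k(4))
  qed simp
  moreover have "H (0, s) = concat_loops p q s" "H (1, s) = concat_loops p' q' s" for s
    by (simp_all add: H_def concat_loops_def h k)
  moreover have "H (t, 0) = x \<and> H (t, 1) = x" if "t \<in> {0..1}" for t
    using h(4)[OF that] k(4)[OF that] by (simp add: H_def)
  ultimately show ?thesis
    unfolding homotopic_with_def by blast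
qed

lemma concat_in_loops:
  assumes "p \<in> loops X x" "q \<in> loops X x"
  shows "concat_loops p q \<in> loops X x"
  by (rule loop_homotopic_imp_loops(1)[OF concat_homotopic])
    (use assms in \<open>auto intro: loop_homotopic_refl\<close>)

text \<open>The operations of \<^const>\<open>pi1\<close> and \<^const>\<open>pi1_map\<close> are unions over all representatives of the
  classes. They are well defined because the sets in the union do not depend on the representatives.\<close>

lemma UN_UN_constant:
  assumes "a \<in> A" "b \<in> B" "\<And>x y. x \<in> A \<Longrightarrow> y \<in> B \<Longrightarrow> f x y = c"
  shows "(\<Union>x\<in>A. \<Union>y\<in>B. f x y) = c"
  using assms by blast

lemma pi1_carrierE:
  assumes "A \<in> carrier (pi1 X x)"
  obtains p where "p \<in> loops X x" "A = loop_class X x p"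
  using assms by (auto simp: pi1_def)

lemma loop_class_in_pi1: "p \<in> loops X x \<Longrightarrow> loop_class X x p \<in> carrier (pi1 X x)"
  by (auto simp: pi1_def)

lemma pi1_mult:
  assumes "p \<in> loops X x" "q \<in> loops X x"
  shows "loop_class X x p \<otimes>\<^bsub>pi1 X x\<^esub> loop_class X x q = loop_class X x (concat_loops p q)"
proof -
  have "loop_class X x (concat_loops p' q') = loop_class X x (concat_loops p q)"
    if "p' \<in> loop_class X x p" "q' \<in> loop_class X x q" for p' q'
    by (rule loop_class_eq[symmetric]) (intro concat_homotopic in_loop_classD that)
  from UN_UN_constant[OF assms[THEN self_in_loop_class] this] show ?thesis
    by (simp add: pi1_def)
qed

lemma comp_in_loops:
  assumes "pointed_map X x Y y f" "p \<in> loops X x"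
  shows "f \<circ> p \<in> loops Y y"
  using assms by (auto simp: loops_iff pointed_map_def intro: continuous_map_compose)

lemma pi1_map_loop_class:
  assumes f: "pointed_map X x Y y f" and p: "p \<in> loops X x"
  shows "pi1_map Y y f (loop_class X x p) = loop_class Y y (f \<circ> p)"
proof -
  have "loop_class Y y (f \<circ> q) = loop_class Y y (f \<circ> p)" if "q \<in> loop_class X x p" for q
    by (rule loop_class_eq[symmetric], rule homotopic_with_compose_continuous_map_left
        [OF in_loop_classD[OF that]]) (use f in \<open>auto simp: pointed_map_def\<close>)
  with self_in_loop_class[OF p] show ?thesis
    unfolding pi1_map_def by blast
qed

lemma pi1_map_hom:
  assumes f: "pointed_map X x Y y f"
  shows "pi1_map Y y f \<in> hom (pi1 X x) (pi1 Y y)"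
proof (rule homI)
  fix A assume "A \<in> carrier (pi1 X x)"
  then show "pi1_map Y y f A \<in> carrier (pi1 Y y)"
    by (elim pi1_carrierE) (simp add: pi1_map_loop_class[OF f] loop_class_in_pi1 comp_in_loops[OF f])
next
  fix A B assume "A \<in> carrier (pi1 X x)" "B \<in> carrier (pi1 X x)"
  then obtain p q where pq: "p \<in> loops X x" "A = loop_class X x p" "q \<in> loops X x" "B = loop_class X x q"
    by (elim pi1_carrierE) blast
  have "f \<circ> concat_loops p q = concat_loops (f \<circ> p) (f \<circ> q)"
    by (auto simp: concat_loops_def)
  then show "pi1_map Y y f (A \<otimes>\<^bsub>pi1 X x\<^esub> B) = pi1_map Y y f A \<otimes>\<^bsub>pi1 Y y\<^esub> pi1_map Y y f B"
    using pq by (simp add: pi1_mult pi1_map_loop_class[OF f] concat_in_loops comp_in_loops[OF f])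
qed

lemma pi1_map_compose:
  assumes "pointed_map X x Y y f" "pointed_map Y y Z z g" "A \<in> carrier (pi1 X x)"
  shows "pi1_map Z z g (pi1_map Y y f A) = pi1_map Z z (g \<circ> f) A"
proof -
  have "pointed_map X x Z z (g \<circ> f)"
    using assms(1,2) by (auto simp: pointed_map_def intro: continuous_map_compose)
  with assms show ?thesis
    by (elim pi1_carrierE) (simp add: pi1_map_loop_class comp_in_loops comp_assoc)
qed

lemma pi1_map_id:
  assumes "A \<in> carrier (pi1 X x)"
  shows "pi1_map X x id A = A"
  using assms by (elim pi1_carrierE) (simp add: pi1_map_loop_class[of X x X x id] pointed_map_def)

lemma pointed_homotopic_imp_pointed_map:
  assumes "pointed_homotopic X x Y y f g"
  shows "pointed_map X x Y y f" "pointed_map X x Y y g"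
  using homotopic_with_imp_continuous_maps[OF assms[unfolded pointed_homotopic_def]]
    homotopic_with_imp_property[OF assms[unfolded pointed_homotopic_def]]
  by (auto simp: pointed_map_def)

lemma pi1_map_homotopic:
  assumes fg: "pointed_homotopic X x Y y f g" and A: "A \<in> carrier (pi1 X x)"
  shows "pi1_map Y y f A = pi1_map Y y g A"
proof -
  obtain p where p: "p \<in> loops X x" "A = loop_class X x p"
    using A by (rule pi1_carrierE)
  have "loop_homotopic Y y (f \<circ> p) (g \<circ> p)"
    by (rule homotopic_with_compose_continuous_map_right[OF fg[unfolded pointed_homotopic_def]])
      (use p in \<open>auto simp: loops_iff\<close>)
  then show ?thesis
    using p fg[THEN pointed_homotopic_imp_pointed_map(1)] fg[THEN pointed_homotopic_imp_pointed_map(2)]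
    by (simp add: pi1_map_loop_class loop_class_eq)
qed

lemma pointed_homotopic_trans:
  "pointed_homotopic X x Y y f g \<Longrightarrow> pointed_homotopic X x Y y g h \<Longrightarrow> pointed_homotopic X x Y y f h"
  unfolding pointed_homotopic_def by (rule homotopic_with_trans)

lemma pointed_homotopic_sym:
  "pointed_homotopic X x Y y f g \<Longrightarrow> pointed_homotopic X x Y y g f"
  unfolding pointed_homotopic_def by (rule homotopic_with_symD)

lemma pointed_homotopic_compose_left:
  "pointed_homotopic X x Y y f g \<Longrightarrow> pointed_map Y y Z z h \<Longrightarrow>
    pointed_homotopic X x Z z (h \<circ> f) (h \<circ> g)"
  unfolding pointed_homotopic_def pointed_map_def
  by (elim conjE, erule homotopic_with_compose_continuous_map_left) auto

lemma pointed_homotopic_compose_right: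
  "pointed_homotopic Y y Z z f g \<Longrightarrow> pointed_map X x Y y h \<Longrightarrow>
    pointed_homotopic X x Z z (f \<circ> h) (g \<circ> h)"
  unfolding pointed_homotopic_def pointed_map_def
  by (elim conjE, erule homotopic_with_compose_continuous_map_right) auto

lemma pointed_homotopic_equal:
  assumes "pointed_map X x Y y f" "x \<in> topspace X" "\<And>z. z \<in> topspace X \<Longrightarrow> f z = g z"
  shows "pointed_homotopic X x Y y f g"
  unfolding pointed_homotopic_def
  by (rule homotopic_with_equal) (use assms in \<open>auto simp: pointed_map_def\<close>)

lemma pointed_map_compose:
  "pointed_map X x Y y f \<Longrightarrow> pointed_map Y y Z z g \<Longrightarrow> pointed_map X x Z z (g \<circ> f)"
  by (auto simp: pointed_map_def intro: continuous_map_compose)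

section \<open>Interleaved inverse sequences\<close>

text \<open>The bonding maps are homomorphisms.\<close>

definition inverse_system :: "'g pro_group \<Rightarrow> bool" where
  "inverse_system P \<longleftrightarrow> (\<forall>i. snd P i \<in> hom (fst P (Suc i)) (fst P i))"

lemma composite_down_add:
  "composite_down p k (m + n) = composite_down p k m \<circ> composite_down p (k + m) n"
  by (induction n) (auto simp: add.assoc comp_assoc)

lemma structure_map_self [simp]: "structure_map p i i = id"
  by (simp add: structure_map_def)

lemma structure_map_Suc: "structure_map p (Suc i) i = p i"
  by (simp add: structure_map_def)

lemma structure_map_trans:
  assumes "k \<le> j" "j \<le> i"
  shows "structure_map p j k (structure_map p i j x) = structure_map p i k x"
proof -
  have "i - k = (j - k) + (i - j)" and kj: "k + (j - k) = j" using assms by auto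
  then have "composite_down p k (i - k) = composite_down p k (j - k) \<circ> composite_down p j (i - j)"
    by (metis composite_down_add)
  then show ?thesis by (simp add: structure_map_def)
qed

lemma structure_map_hom:
  assumes "inverse_system P" "k \<le> i"
  shows "structure_map (snd P) i k \<in> hom (fst P i) (fst P k)"
proof -
  have "composite_down (snd P) k m \<in> hom (fst P (k + m)) (fst P k)" for m
  proof (induction m)
    case (Suc m)
    have "snd P (k + m) \<in> hom (fst P (k + Suc m)) (fst P (k + m))"
      using assms(1) by (simp add: inverse_system_def)
    from hom_compose[OF this Suc] show ?case by (simp add: comp_def)
  qed (simp add: hom_def)
  from this[of "i - k"] show ?thesis using assms(2) by (simp add: structure_map_def)
qed

lemma structure_map_closed:
  "inverse_system P \<Longrightarrow> k \<le> i \<Longrightarrow> x \<in> carrier (fst P i) \<Longrightarrow>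
    structure_map (snd P) i k x \<in> carrier (fst P k)"
  by (rule hom_in_carrier[OF structure_map_hom])

text \<open>Two inverse sequences are interleaved if cofinal subsequences of them fit into a commutative
  zigzag of homomorphisms
  \<open>G (a 0) \<leftarrow> H (b 0) \<leftarrow> G (a 1) \<leftarrow> H (b 1) \<leftarrow> \<dots>\<close>.\<close>

definition interleaving ::
  "'g pro_group \<Rightarrow> 'h pro_group \<Rightarrow> (nat \<Rightarrow> nat) \<Rightarrow> (nat \<Rightarrow> nat) \<Rightarrow>
    (nat \<Rightarrow> 'g \<Rightarrow> 'h) \<Rightarrow> (nat \<Rightarrow> 'h \<Rightarrow> 'g) \<Rightarrow> bool" where
  "interleaving P Q a b \<alpha> \<beta> \<longleftrightarrow> strict_mono a \<and> strict_mono b \<and>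
     (\<forall>k. \<alpha> k \<in> hom (fst P (a (Suc k))) (fst Q (b k))) \<and>
     (\<forall>k. \<beta> k \<in> hom (fst Q (b k)) (fst P (a k))) \<and>
     (\<forall>k. \<forall>x\<in>carrier (fst P (a (Suc k))). \<beta> k (\<alpha> k x) = structure_map (snd P) (a (Suc k)) (a k) x) \<and>
     (\<forall>k. \<forall>y\<in>carrier (fst Q (b (Suc k))).
        \<alpha> k (\<beta> (Suc k) y) = structure_map (snd Q) (b (Suc k)) (b k) y)"

text \<open>For increasing \<open>c\<close>, the stage of \<open>i\<close> is the last index \<open>k\<close> with \<open>c k \<le> i\<close>, and \<open>0\<close> if there is
  none.\<close>

definition stage :: "(nat \<Rightarrow> nat) \<Rightarrow> nat \<Rightarrow> nat" where
  "stage c i = (LEAST k. i < c (Suc k))"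

context
  fixes c :: "nat \<Rightarrow> nat"
  assumes c: "strict_mono c"
begin

lemma stage_less: "i < c (Suc (stage c i))"
  unfolding stage_def by (rule LeastI[of _ i]) (metis c strict_mono_imp_increasing Suc_le_lessD)

lemma stage_le:
  assumes "c 0 \<le> i" shows "c (stage c i) \<le> i"
proof (cases "stage c i")
  case (Suc k)
  then have "\<not> i < c (Suc k)"
    using not_less_Least[of k "\<lambda>k. i < c (Suc k)"] by (simp add: stage_def)
  with Suc show ?thesis by simp
qed (use assms in simp)

lemma mono_stage: "mono (stage c)"
proof (rule monoI)
  fix i i' :: nat assume "i \<le> i'"
  then have "i < c (Suc (stage c i'))" using stage_less[of i'] by simp
  then show "stage c i \<le> stage c i'" unfolding stage_def[of c i] by (rule Least_le)
qed

lemma stage_at: "stage c (c k) = k"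
  unfolding stage_def
  by (rule Least_equality) (use c in \<open>auto simp: strict_mono_less\<close>)

lemma stage_at_top: "filterlim (stage c) at_top at_top"
  unfolding filterlim_at_top eventually_at_top_linorder
  by (metis mono_stage monoD stage_at)

end

text \<open>Without its first term, the zigzag starts with the other sequence.\<close>

lemma interleaving_sym:
  assumes "interleaving P Q a b \<alpha> \<beta>"
  shows "interleaving Q P b (\<lambda>k. a (Suc k)) (\<lambda>k. \<beta> (Suc k)) \<alpha>"
  using assms unfolding interleaving_def strict_mono_def by simp

lemma strict_mono_Suc_shift: "strict_mono (a :: nat \<Rightarrow> nat) \<Longrightarrow> strict_mono (\<lambda>k. a (Suc k))"
  by (simp add: strict_mono_def)

context
  fixes P :: "'g pro_group" and Q :: "'h pro_group" and a b \<alpha> \<beta>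
  assumes P: "inverse_system P" and Q: "inverse_system Q"
    and I: "interleaving P Q a b \<alpha> \<beta>"
begin

lemma interleavingD:
  "strict_mono a" "strict_mono b"
  "\<alpha> k \<in> hom (fst P (a (Suc k))) (fst Q (b k))"
  "\<beta> k \<in> hom (fst Q (b k)) (fst P (a k))"
  "x \<in> carrier (fst P (a (Suc k))) \<Longrightarrow> \<beta> k (\<alpha> k x) = structure_map (snd P) (a (Suc k)) (a k) x"
  "y \<in> carrier (fst Q (b (Suc k))) \<Longrightarrow>
    \<alpha> k (\<beta> (Suc k) y) = structure_map (snd Q) (b (Suc k)) (b k) y"
  using I by (auto simp: interleaving_def)

text \<open>The maps \<open>\<beta>\<close> commute with the structure maps, because \<open>\<beta> l \<circ> \<alpha> l \<circ> \<beta> (l + 1)\<close> can be bracketed in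
  two ways.\<close>

lemma interleaving_natural:
  assumes "k \<le> l" "y \<in> carrier (fst Q (b l))"
  shows "\<beta> k (structure_map (snd Q) (b l) (b k) y) = structure_map (snd P) (a l) (a k) (\<beta> l y)"
  using assms
proof (induction l arbitrary: y rule: dec_induct)
  case (step l)
  have le: "a k \<le> a l" "a l \<le> a (Suc l)" "b k \<le> b l" "b l \<le> b (Suc l)"
    using interleavingD(1,2) step.hyps(1) by (auto simp: strict_mono_less_eq)
  let ?z = "structure_map (snd Q) (b (Suc l)) (b l) y"
  have "?z \<in> carrier (fst Q (b l))"
    using structure_map_closed[OF Q le(4) step.prems] .
  from step.IH[OF this] have "\<beta> k (structure_map (snd Q) (b (Suc l)) (b k) y) =
      structure_map (snd P) (a l) (a k) (\<beta> l ?z)"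
    by (simp add: structure_map_trans[OF le(3,4)])
  also have "\<beta> l ?z = structure_map (snd P) (a (Suc l)) (a l) (\<beta> (Suc l) y)"
    using step.prems interleavingD(6)[of y l]
      interleavingD(5)[OF hom_in_carrier[OF interleavingD(4)], of y l] by simp
  finally show ?case by (simp add: structure_map_trans[OF le(1,2)])
qed simp

end

text \<open>The homomorphism out of \<open>H m\<close> that descends to the last stage below \<open>m\<close> and then crosses over
  by \<open>\<beta>\<close>.\<close>

definition crossing :: "'h pro_group \<Rightarrow> (nat \<Rightarrow> nat) \<Rightarrow> (nat \<Rightarrow> 'h \<Rightarrow> 'g) \<Rightarrow> nat \<Rightarrow> 'h \<Rightarrow> 'g" where
  "crossing Q b \<beta> m = \<beta> (stage b m) \<circ> structure_map (snd Q) m (b (stage b m))"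

lemma crossing_pro_morphism:
  assumes P: "inverse_system P" and Q: "inverse_system Q" and I: "interleaving P Q a b \<alpha> \<beta>"
  shows "pro_morphism Q P (b 0) (\<lambda>m. a (stage b m)) (crossing Q b \<beta>)"
proof -
  let ?s = "stage b"
  note ID = interleavingD[OF P Q I]
  note le = stage_le[OF ID(2)]
  have mono: "mono (\<lambda>m. a (?s m))"
    using mono_stage[OF ID(2)] ID(1) by (simp add: mono_def strict_mono_less_eq)
  have "filterlim (\<lambda>m. a (?s m)) at_top at_top"
    by (rule filterlim_compose[OF filterlim_subseq[OF ID(1)] stage_at_top[OF ID(2)]])
  moreover have "crossing Q b \<beta> m \<in> hom (fst Q m) (fst P (a (?s m)))" if "m \<ge> b 0" for m
    unfolding crossing_def
    by (rule hom_compose[OF structure_map_hom[OF Q le[OF that]] ID(4)])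
  moreover have "crossing Q b \<beta> m (structure_map (snd Q) m' m x) =
      structure_map (snd P) (a (?s m')) (a (?s m)) (crossing Q b \<beta> m' x)"
    if m: "m \<ge> b 0" and mm: "m' \<ge> m" and x: "x \<in> carrier (fst Q m')" for m m' x
  proof -
    have m': "m' \<ge> b 0" using m mm by simp
    have ss: "?s m \<le> ?s m'" using mono_stage[OF ID(2)] mm by (simp add: mono_def)
    then have bb: "b (?s m) \<le> b (?s m')" using ID(2) by (simp add: strict_mono_less_eq)
    have "crossing Q b \<beta> m (structure_map (snd Q) m' m x) =
        \<beta> (?s m) (structure_map (snd Q) m' (b (?s m)) x)"
      by (simp add: crossing_def structure_map_trans[OF le[OF m] mm])
    also have "\<dots> = \<beta> (?s m) (structure_map (snd Q) (b (?s m')) (b (?s m))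
        (structure_map (snd Q) m' (b (?s m')) x))"
      by (simp add: structure_map_trans[OF bb le[OF m']])
    also have "\<dots> = structure_map (snd P) (a (?s m')) (a (?s m)) (crossing Q b \<beta> m' x)"
      unfolding crossing_def comp_def
      by (rule interleaving_natural[OF P Q I ss structure_map_closed[OF Q le[OF m'] x]])
    finally show ?thesis .
  qed
  ultimately show ?thesis
    using mono unfolding pro_morphism_def by blast
qed

proposition interleaving_imp_pro_equivalent:
  assumes P: "inverse_system P" and Q: "inverse_system Q" and I: "interleaving P Q a b \<alpha> \<beta>"
  shows "pro_equivalent P Q"
proof -
  let ?a = "\<lambda>k. a (Suc k)"
  let ?j = "\<lambda>i. b (stage ?a i)" and ?k = "\<lambda>m. a (stage b m)"
  let ?f = "crossing P ?a \<alpha>" and ?g = "crossing Q b \<beta>"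
  note ID = interleavingD[OF P Q I]
  note a' = strict_mono_Suc_shift[OF ID(1)]
  \<comment> \<open>Crossing from \<open>P\<close> to \<open>Q\<close> lands exactly at the stage \<open>b s\<close>, so the way back starts there with \<open>\<beta> s\<close>.\<close>
  have "?k (?j i) \<le> i \<and> (\<forall>x\<in>carrier (fst P i). ?g (?j i) (?f i x) =
      structure_map (snd P) i (?k (?j i)) x)" if i: "a 1 \<le> i" for i
  proof -
    let ?s = "stage ?a i"
    have le: "?a ?s \<le> i" using stage_le[OF a', of i] i by simp
    have le': "a ?s \<le> ?a ?s" using ID(1) by (simp add: strict_mono_less_eq)
    have "\<beta> ?s (?f i x) = structure_map (snd P) i (a ?s) x" if "x \<in> carrier (fst P i)" for x
      using ID(5)[OF structure_map_closed[OF P le that]]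
      by (simp add: crossing_def structure_map_trans[OF le' le])
    then show ?thesis
      using le le' by (simp add: crossing_def[of Q] stage_at[OF ID(2)])
  qed
  moreover have "?j (?k m) \<le> m \<and> (\<forall>x\<in>carrier (fst Q m). ?f (?k m) (?g m x) =
      structure_map (snd Q) m (?j (?k m)) x)" if m: "b 0 \<le> m" and km: "a 1 \<le> ?k m" for m
  proof -
    \<comment> \<open>No homomorphism leads from \<open>P (a 0)\<close> to \<open>Q\<close>; the bound \<open>km\<close> keeps away from this level.\<close>
    have "stage b m \<noteq> 0"
      using km ID(1) by (metis One_nat_def not_less strict_mono_less zero_less_one)
    then obtain s where s: "stage b m = Suc s"
      using not0_implies_Suc by blast
    have le: "b (Suc s) \<le> m" using stage_le[OF ID(2) m] by (simp add: s)
    have le': "b s \<le> b (Suc s)" using ID(2) by (simp add: strict_mono_less_eq)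
    have st: "stage ?a (a (Suc s)) = s" by (rule stage_at[OF a'])
    have "\<alpha> s (?g m x) = structure_map (snd Q) m (b s) x" if "x \<in> carrier (fst Q m)" for x
      using ID(6)[OF structure_map_closed[OF Q le that]]
      by (simp add: crossing_def s structure_map_trans[OF le' le])
    then show ?thesis
      using le le' by (simp add: crossing_def[of P] s st)
  qed
  ultimately have "composes_to_structure_maps P (a 1) ?j ?f (b 0) ?k ?g"
    "composes_to_structure_maps Q (b 0) ?k ?g (a 1) ?j ?f"
    unfolding composes_to_structure_maps_def by blast+
  moreover have "pro_morphism P Q (a 1) ?j ?f"
    using crossing_pro_morphism[OF Q P interleaving_sym[OF I]] by simp
  ultimately show ?thesis
    using crossing_pro_morphism[OF P Q I] unfolding pro_equivalent_def by blast
qed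

lemma inverse_limit_structure_map:
  assumes "s \<in> carrier (inverse_limit P)" "k \<le> i"
  shows "structure_map (snd P) i k (s i) = s k"
  using assms(2)
proof (induction i rule: dec_induct)
  case (step i)
  have "structure_map (snd P) (Suc i) k (s (Suc i)) =
      structure_map (snd P) i k (structure_map (snd P) (Suc i) i (s (Suc i)))"
    using step.hyps by (simp add: structure_map_trans)
  also have "structure_map (snd P) (Suc i) i (s (Suc i)) = s i"
    using assms(1) by (simp add: inverse_limit_def structure_map_Suc)
  finally show ?case using step.IH by simp
qed simp

text \<open>The map of inverse limits that is induced by \<open>\<beta>\<close>. The element \<open>\<beta> m (t (b m))\<close> lies at level \<open>a m \<ge> m\<close>
  and is brought down to level \<open>m\<close>.\<close>

definition limit_map :: "'g pro_group \<Rightarrow> (nat \<Rightarrow> nat) \<Rightarrow> (nat \<Rightarrow> nat) \<Rightarrow> (nat \<Rightarrow> 'h \<Rightarrow> 'g) \<Rightarrow>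
    (nat \<Rightarrow> 'h) \<Rightarrow> nat \<Rightarrow> 'g" where
  "limit_map P a b \<beta> t m = structure_map (snd P) (a m) m (\<beta> m (t (b m)))"

lemma limit_map:
  assumes P: "inverse_system P" and Q: "inverse_system Q" and I: "interleaving P Q a b \<alpha> \<beta>"
  shows limit_map_hom: "limit_map P a b \<beta> \<in> hom (inverse_limit Q) (inverse_limit P)"
    and limit_map_at: "t \<in> carrier (inverse_limit Q) \<Longrightarrow> limit_map P a b \<beta> t (a k) = \<beta> k (t (b k))"
proof -
  note ID = interleavingD[OF P Q I]
  note am = strict_mono_imp_increasing[OF ID(1)]
  have t: "t i \<in> carrier (fst Q i)" if "t \<in> carrier (inverse_limit Q)" for t i
    using that by (simp add: inverse_limit_def)
  have nat: "structure_map (snd P) (a l) (a k) (\<beta> l (t (b l))) = \<beta> k (t (b k))"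
    if "t \<in> carrier (inverse_limit Q)" "k \<le> l" for t k l
  proof -
    have "b k \<le> b l" using that(2) ID(2) by (simp add: strict_mono_less_eq)
    then show ?thesis
      using interleaving_natural[OF P Q I that(2) t[OF that(1)]]
      by (simp add: inverse_limit_structure_map[OF that(1)])
  qed
  have \<beta>t: "\<beta> m (t (b m)) \<in> carrier (fst P (a m))" if "t \<in> carrier (inverse_limit Q)" for t m
    by (rule hom_in_carrier[OF ID(4) t[OF that]])
  show at: "limit_map P a b \<beta> t (a k) = \<beta> k (t (b k))" if tt: "t \<in> carrier (inverse_limit Q)" for t k
    unfolding limit_map_def by (rule nat[OF tt am])
  show "limit_map P a b \<beta> \<in> hom (inverse_limit Q) (inverse_limit P)"
  proof (rule homI)
    fix t assume tt: "t \<in> carrier (inverse_limit Q)"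
    have "snd P m (limit_map P a b \<beta> t (Suc m)) = limit_map P a b \<beta> t m" for m
    proof -
      have le: "a m \<le> a (Suc m)" using ID(1) by (simp add: strict_mono_less_eq)
      have "snd P m (limit_map P a b \<beta> t (Suc m)) =
          structure_map (snd P) (a (Suc m)) m (\<beta> (Suc m) (t (b (Suc m))))"
        using structure_map_trans[of m "Suc m" "a (Suc m)" "snd P"] am[of "Suc m"]
        by (simp add: limit_map_def structure_map_Suc)
      also have "\<dots> = structure_map (snd P) (a m) m
          (structure_map (snd P) (a (Suc m)) (a m) (\<beta> (Suc m) (t (b (Suc m)))))"
        by (simp add: structure_map_trans[OF am le])
      also have "\<dots> = limit_map P a b \<beta> t m"
        using nat[OF tt, of m "Suc m"] by (simp add: limit_map_def)
      finally show ?thesis .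
    qed
    moreover have "limit_map P a b \<beta> t m \<in> carrier (fst P m)" for m
      unfolding limit_map_def by (rule structure_map_closed[OF P am \<beta>t[OF tt]])
    ultimately show "limit_map P a b \<beta> t \<in> carrier (inverse_limit P)"
      by (simp add: inverse_limit_def)
  next
    fix t u assume tu: "t \<in> carrier (inverse_limit Q)" "u \<in> carrier (inverse_limit Q)"
    show "limit_map P a b \<beta> (t \<otimes>\<^bsub>inverse_limit Q\<^esub> u) =
        limit_map P a b \<beta> t \<otimes>\<^bsub>inverse_limit P\<^esub> limit_map P a b \<beta> u"
      using hom_mult[OF ID(4) t[OF tu(1)] t[OF tu(2)]]
        hom_mult[OF structure_map_hom[OF P am] \<beta>t[OF tu(1)] \<beta>t[OF tu(2)]]
      by (auto simp: inverse_limit_def limit_map_def)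
  qed
qed

proposition interleaving_imp_inverse_limit_iso:
  assumes P: "inverse_system P" and Q: "inverse_system Q" and I: "interleaving P Q a b \<alpha> \<beta>"
  shows "inverse_limit P \<cong> inverse_limit Q"
proof -
  let ?a = "\<lambda>k. a (Suc k)"
  let ?A = "limit_map Q b ?a \<alpha>" and ?B = "limit_map P a b \<beta>"
  note ID = interleavingD[OF P Q I]
  note A = limit_map[OF Q P interleaving_sym[OF I]] and B = limit_map[OF P Q I]
  have "?B (?A s) = s" if s: "s \<in> carrier (inverse_limit P)" for s
  proof
    fix m
    have am: "m \<le> a m" "a m \<le> ?a m"
      using ID(1) by (simp_all add: strict_mono_imp_increasing strict_mono_less_eq)
    have "s (?a m) \<in> carrier (fst P (?a m))" using s by (simp add: inverse_limit_def)
    then have "\<beta> m (?A s (b m)) = s (a m)"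
      by (simp add: A(2)[OF s] ID(5) inverse_limit_structure_map[OF s am(2)])
    then show "?B (?A s) m = s m"
      by (simp add: limit_map_def[of P] inverse_limit_structure_map[OF s am(1)])
  qed
  moreover have "?A (?B t) = t" if t: "t \<in> carrier (inverse_limit Q)" for t
  proof
    fix m
    have bm: "m \<le> b m" "b m \<le> b (Suc m)"
      using ID(2) by (simp_all add: strict_mono_imp_increasing strict_mono_less_eq)
    have "t (b (Suc m)) \<in> carrier (fst Q (b (Suc m)))" using t by (simp add: inverse_limit_def)
    then have "\<alpha> m (?B t (?a m)) = t (b m)"
      by (simp add: B(2)[OF t] ID(6) inverse_limit_structure_map[OF t bm(2)])
    then show "?A (?B t) m = t m"
      by (simp add: limit_map_def[of Q] inverse_limit_structure_map[OF t bm(1)])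
  qed
  ultimately have "bij_betw ?A (carrier (inverse_limit P)) (carrier (inverse_limit Q))"
    using hom_in_carrier[OF A(1)] hom_in_carrier[OF B(1)]
    by (intro bij_betw_byWitness[where f' = ?B]) auto
  with A(1) show ?thesis
    by (auto simp: is_iso_def iso_def)
qed

section \<open>Sequences of pointed spaces and expansions\<close>

text \<open>The bonding maps are continuous and preserve the base points.\<close>

definition pointed_system :: "(nat \<Rightarrow> 'x topology) \<Rightarrow> (nat \<Rightarrow> 'x) \<Rightarrow> (nat \<Rightarrow> 'x \<Rightarrow> 'x) \<Rightarrow> bool" where
  "pointed_system Xs xs b \<longleftrightarrow>
     (\<forall>i. pointed_map (Xs (Suc i)) (xs (Suc i)) (Xs i) (xs i) (b i))"

lemma structure_map_comp:
  "k \<le> j \<Longrightarrow> j \<le> i \<Longrightarrow> structure_map p j k \<circ> structure_map p i j = structure_map p i k"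
  by (auto simp: structure_map_trans)

lemma pointed_structure_map:
  assumes "pointed_system Xs xs b" "k \<le> i"
  shows "pointed_map (Xs i) (xs i) (Xs k) (xs k) (structure_map b i k)"
  using assms(2)
proof (induction i rule: dec_induct)
  case (step i)
  have "pointed_map (Xs (Suc i)) (xs (Suc i)) (Xs i) (xs i) (structure_map b (Suc i) i)"
    using assms(1) by (simp add: pointed_system_def structure_map_Suc)
  from pointed_map_compose[OF this step.IH] show ?case
    using step.hyps by (simp add: structure_map_comp)
qed (simp add: pointed_map_def)

lemma inverse_system_pi1_sequence:
  "pointed_system Xs xs b \<Longrightarrow> inverse_system (pi1_sequence Xs xs b)"
  by (simp add: inverse_system_def pi1_sequence_def pointed_system_def pi1_map_hom)

lemma structure_map_pi1_sequence:
  assumes S: "pointed_system Xs xs b" and "k \<le> i" and "A \<in> carrier (pi1 (Xs i) (xs i))"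
  shows "structure_map (snd (pi1_sequence Xs xs b)) i k A = pi1_map (Xs k) (xs k) (structure_map b i k) A"
  using assms(2,3)
proof (induction i arbitrary: A rule: dec_induct)
  case (step i)
  let ?p = "snd (pi1_sequence Xs xs b)"
  have pt: "pointed_map (Xs (Suc i)) (xs (Suc i)) (Xs i) (xs i) (b i)"
    using S by (simp add: pointed_system_def)
  have "structure_map ?p (Suc i) k A = structure_map ?p i k (structure_map ?p (Suc i) i A)"
    using step.hyps by (simp add: structure_map_trans)
  also have "\<dots> = structure_map ?p i k (pi1_map (Xs i) (xs i) (b i) A)"
    by (simp add: structure_map_Suc pi1_sequence_def)
  also have "\<dots> = pi1_map (Xs k) (xs k) (structure_map b i k) (pi1_map (Xs i) (xs i) (b i) A)"
    by (rule step.IH) (rule hom_in_carrier[OF pi1_map_hom[OF pt] step.prems])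
  also have "\<dots> = pi1_map (Xs k) (xs k) (structure_map b i k \<circ> structure_map b (Suc i) i) A"
    using pi1_map_compose[OF pt pointed_structure_map[OF S step.hyps(1)] step.prems]
    by (simp add: structure_map_Suc)
  also have "structure_map b i k \<circ> structure_map b (Suc i) i = structure_map b (Suc i) k"
    using step.hyps by (simp add: structure_map_comp)
  finally show ?case .
qed (simp add: pi1_map_id)

text \<open>A zigzag of pointed maps which commutes up to pointed homotopy interleaves the sequences of
  fundamental groups.\<close>

lemma interleaving_pi1_sequence:
  assumes S: "pointed_system Xs xs p" and R: "pointed_system Ys ys q"
    and a: "strict_mono a" and b: "strict_mono b"
    and f: "\<And>k. pointed_map (Ys (b k)) (ys (b k)) (Xs (a k)) (xs (a k)) (f k)"
    and g: "\<And>k. pointed_map (Xs (a (Suc k))) (xs (a (Suc k))) (Ys (b k)) (ys (b k)) (g k)"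
    and fg: "\<And>k. pointed_homotopic (Xs (a (Suc k))) (xs (a (Suc k))) (Xs (a k)) (xs (a k))
      (f k \<circ> g k) (structure_map p (a (Suc k)) (a k))"
    and gf: "\<And>k. pointed_homotopic (Ys (b (Suc k))) (ys (b (Suc k))) (Ys (b k)) (ys (b k))
      (g k \<circ> f (Suc k)) (structure_map q (b (Suc k)) (b k))"
  shows "interleaving (pi1_sequence Xs xs p) (pi1_sequence Ys ys q) a b
    (\<lambda>k. pi1_map (Ys (b k)) (ys (b k)) (g k)) (\<lambda>k. pi1_map (Xs (a k)) (xs (a k)) (f k))"
proof -
  have le: "a k \<le> a (Suc k)" "b k \<le> b (Suc k)" for k
    using a b by (simp_all add: strict_mono_less_eq)
  show ?thesis
    unfolding interleaving_def
    using a b pi1_map_hom[OF f] pi1_map_hom[OF g] pi1_map_compose[OF g f]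
      pi1_map_compose[OF f g] pi1_map_homotopic[OF fg] pi1_map_homotopic[OF gf]
      structure_map_pi1_sequence[OF S le(1)] structure_map_pi1_sequence[OF R le(2)]
    by (simp add: pi1_sequence_def)
qed

text \<open>The two conditions in the definition of an expansion: maps to CW complexes factor up to homotopy,
  and the factorisation is unique after passing to a later term.\<close>

lemma cw_expansion_factor:
  fixes P :: "'u topology" and Xs :: "nat \<Rightarrow> 'u topology"
  assumes "cw_expansion X x Xs xs b p" "cw_complex P" "y \<in> topspace P" "pointed_map X x P y f"
  shows "\<exists>i g. pointed_map (Xs i) (xs i) P y g \<and> pointed_homotopic X x P y (g \<circ> p i) f"
  using assms(1)[unfolded cw_expansion_def, THEN conjunct2, THEN conjunct1] assms(2-4) by simp

lemma cw_expansion_unique: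
  fixes P :: "'u topology" and Xs :: "nat \<Rightarrow> 'u topology"
  assumes "cw_expansion X x Xs xs b p" "cw_complex P" "y \<in> topspace P"
    "pointed_map (Xs i) (xs i) P y g" "pointed_map (Xs i) (xs i) P y h"
    "pointed_homotopic X x P y (g \<circ> p i) (h \<circ> p i)"
  shows "\<exists>i'\<ge>i. pointed_homotopic (Xs i') (xs i') P y
    (g \<circ> structure_map b i' i) (h \<circ> structure_map b i' i)"
  using assms(1)[unfolded cw_expansion_def, THEN conjunct2, THEN conjunct2, rule_format,
      OF conjI[OF assms(2) conjI[OF assms(3) conjI[OF assms(4) conjI[OF assms(5,6)]]]]] .

lemma cw_expansion_projection:
  assumes "cw_expansion X x Xs xs b p" "k \<le> i"
  shows "pointed_homotopic X x (Xs k) (xs k) (structure_map b i k \<circ> p i) (p k)"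
  using assms(2)
proof (induction i rule: dec_induct)
  case base
  show ?case using assms(1)
    by (auto simp: cw_expansion_def pointed_homotopic_def pointed_map_def)
next
  case (step i)
  have S: "pointed_system Xs xs b" using assms(1) by (simp add: cw_expansion_def pointed_system_def)
  have "pointed_homotopic X x (Xs i) (xs i) (b i \<circ> p (Suc i)) (p i)"
    using assms(1) by (simp add: cw_expansion_def)
  from pointed_homotopic_compose_left[OF this pointed_structure_map[OF S step.hyps(1)]]
  have "pointed_homotopic X x (Xs k) (xs k) (structure_map b (Suc i) k \<circ> p (Suc i))
      (structure_map b i k \<circ> p i)"
    using structure_map_comp[OF step.hyps(1), of "Suc i" b] by (simp add: structure_map_Suc comp_assoc[symmetric])
  then show ?case using step.IH by (rule pointed_homotopic_trans)
qed

text \<open>One half of a turn of the zigzag between two expansions of the same space: a map that lifts the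
  projection of the second expansion is chosen first, and then composed with a structure map of the
  first one, far enough for the triangle to commute up to homotopy.\<close>

lemma cw_expansion_lift:
  fixes Xs Ys :: "nat \<Rightarrow> 'u topology"
  assumes X: "cw_expansion X x Xs xs b p" and Y: "cw_expansion X x Ys ys c q"
    and f: "pointed_map (Ys n) (ys n) (Xs m) (xs m) f"
    and fq: "pointed_homotopic X x (Xs m) (xs m) (f \<circ> q n) (p m)"
  obtains m' g where "m < m'" "pointed_map (Xs m') (xs m') (Ys n) (ys n) g"
    "pointed_homotopic X x (Ys n) (ys n) (g \<circ> p m') (q n)"
    "pointed_homotopic (Xs m') (xs m') (Xs m) (xs m) (f \<circ> g) (structure_map b m' m)"
proof -
  have S: "pointed_system Xs xs b" using X by (simp add: cw_expansion_def pointed_system_def)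
  have cwY: "cw_complex (Ys n)" "ys n \<in> topspace (Ys n)" "pointed_map X x (Ys n) (ys n) (q n)"
    using Y by (simp_all add: cw_expansion_def)
  have cwX: "cw_complex (Xs m)" "xs m \<in> topspace (Xs m)"
    using X by (simp_all add: cw_expansion_def)
  obtain m1 g1 where g1: "pointed_map (Xs m1) (xs m1) (Ys n) (ys n) g1"
    "pointed_homotopic X x (Ys n) (ys n) (g1 \<circ> p m1) (q n)"
    using cw_expansion_factor[OF X cwY] by blast
  \<comment> \<open>Beyond \<open>m1\<close>, for the lift to exist, and beyond \<open>m\<close>, for the zigzag to advance.\<close>
  define M where "M = max m1 (Suc m)"
  have M: "m1 \<le> M" "m \<le> M" "m < M" by (auto simp: M_def)
  define g2 where "g2 = g1 \<circ> structure_map b M m1"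
  have g2: "pointed_map (Xs M) (xs M) (Ys n) (ys n) g2"
    unfolding g2_def by (rule pointed_map_compose[OF pointed_structure_map[OF S M(1)] g1(1)])
  have lift: "pointed_homotopic X x (Ys n) (ys n) (g1 \<circ> structure_map b i m1 \<circ> p i) (q n)"
    if "m1 \<le> i" for i
    using pointed_homotopic_trans[OF pointed_homotopic_compose_left
        [OF cw_expansion_projection[OF X that] g1(1)] g1(2)]
    by (simp add: comp_assoc)
  have "pointed_homotopic X x (Xs m) (xs m) (f \<circ> g2 \<circ> p M) (f \<circ> q n)"
    using pointed_homotopic_compose_left[OF lift[OF M(1)] f] by (simp add: g2_def comp_assoc)
  then have "pointed_homotopic X x (Xs m) (xs m) (f \<circ> g2 \<circ> p M) (structure_map b M m \<circ> p M)"
    using fq pointed_homotopic_sym[OF cw_expansion_projection[OF X M(2)]]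
    by (blast intro: pointed_homotopic_trans)
  from cw_expansion_unique[OF X cwX pointed_map_compose[OF g2 f] pointed_structure_map[OF S M(2)] this]
  obtain m' where m': "M \<le> m'" "pointed_homotopic (Xs m') (xs m') (Xs m) (xs m)
      (f \<circ> g2 \<circ> structure_map b m' M) (structure_map b M m \<circ> structure_map b m' M)"
    by blast
  define g where "g = g2 \<circ> structure_map b m' M"
  have g_eq: "g = g1 \<circ> structure_map b m' m1"
    using structure_map_comp[OF M(1) m'(1), of b] by (simp add: g_def g2_def comp_assoc)
  show thesis
  proof (rule that)
    show "m < m'" using M m'(1) by simp
    show "pointed_map (Xs m') (xs m') (Ys n) (ys n) g"
      unfolding g_def by (rule pointed_map_compose[OF pointed_structure_map[OF S m'(1)] g2])
    show "pointed_homotopic X x (Ys n) (ys n) (g \<circ> p m') (q n)"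
      unfolding g_eq by (rule lift) (use M m'(1) in simp)
    show "pointed_homotopic (Xs m') (xs m') (Xs m) (xs m) (f \<circ> g) (structure_map b m' m)"
      using m'(2) structure_map_comp[OF M(2) m'(1), of b] by (simp add: g_def comp_assoc)
  qed
qed

proposition cw_expansions_interleave:
  fixes Xs Ys :: "nat \<Rightarrow> 'u topology"
  assumes X: "cw_expansion X x Xs xs b p" and Y: "cw_expansion X x Ys ys c q"
  shows "\<exists>m n \<alpha> \<beta>. interleaving (pi1_sequence Xs xs b) (pi1_sequence Ys ys c) m n \<alpha> \<beta>"
proof -
  \<comment> \<open>A state of the construction is a map \<open>f : Y n \<rightarrow> X m\<close> compatible with the projections; \<open>N\<close> relates
    it to the states that one turn of the zigzag can produce from it.\<close>
  define R where "R = (\<lambda>(m, n, f). pointed_map (Ys n) (ys n) (Xs m) (xs m) f \<and>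
    pointed_homotopic X x (Xs m) (xs m) (f \<circ> q n) (p m))"
  define N where "N = (\<lambda>(m, n, f) (m', n', f'). m < m' \<and> n < n' \<and>
    (\<exists>g. pointed_map (Xs m') (xs m') (Ys n) (ys n) g \<and>
      pointed_homotopic (Xs m') (xs m') (Xs m) (xs m) (f \<circ> g) (structure_map b m' m) \<and>
      pointed_homotopic (Ys n') (ys n') (Ys n) (ys n) (g \<circ> f') (structure_map c n' n)))"
  have "\<exists>z. R z"
  proof -
    have "cw_complex (Xs 0)" "xs 0 \<in> topspace (Xs 0)" "pointed_map X x (Xs 0) (xs 0) (p 0)"
      using X by (simp_all add: cw_expansion_def)
    then obtain n f where "pointed_map (Ys n) (ys n) (Xs 0) (xs 0) f"
      "pointed_homotopic X x (Xs 0) (xs 0) (f \<circ> q n) (p 0)"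
      using cw_expansion_factor[OF Y] by blast
    then have "R (0, n, f)" by (simp add: R_def)
    then show ?thesis ..
  qed
  moreover have "\<exists>z'. R z' \<and> N z z'" if "R z" for z
  proof -
    obtain m n f where z: "z = (m, n, f)" by (cases z)
    have f: "pointed_map (Ys n) (ys n) (Xs m) (xs m) f"
      "pointed_homotopic X x (Xs m) (xs m) (f \<circ> q n) (p m)"
      using that by (simp_all add: R_def z)
    obtain m' g where g: "m < m'" "pointed_map (Xs m') (xs m') (Ys n) (ys n) g"
      "pointed_homotopic X x (Ys n) (ys n) (g \<circ> p m') (q n)"
      "pointed_homotopic (Xs m') (xs m') (Xs m) (xs m) (f \<circ> g) (structure_map b m' m)"
      by (rule cw_expansion_lift[OF X Y f])
    obtain n' f' where f': "n < n'" "pointed_map (Ys n') (ys n') (Xs m') (xs m') f'"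
      "pointed_homotopic X x (Xs m') (xs m') (f' \<circ> q n') (p m')"
      "pointed_homotopic (Ys n') (ys n') (Ys n) (ys n) (g \<circ> f') (structure_map c n' n)"
      by (rule cw_expansion_lift[OF Y X g(2,3)])
    have "R (m', n', f') \<and> N z (m', n', f')"
      using g f' by (auto simp: R_def N_def z)
    then show ?thesis ..
  qed
  ultimately obtain z where z: "\<And>k. R (z k)" "\<And>k. N (z k) (z (Suc k))"
    using dependent_nat_choice[of "\<lambda>_. R" "\<lambda>_. N"] by metis
  define m where "m k = fst (z k)" for k
  define n where "n k = fst (snd (z k))" for k
  define f where "f k = snd (snd (z k))" for k
  have z_eq: "z k = (m k, n k, f k)" for k by (simp add: m_def n_def f_def)
  have f: "pointed_map (Ys (n k)) (ys (n k)) (Xs (m k)) (xs (m k)) (f k)" for k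
    using z(1)[of k] by (simp add: z_eq R_def)
  have mn: "strict_mono m" "strict_mono n"
    using z(2) by (simp_all add: z_eq N_def strict_mono_Suc_iff)
  have "\<forall>k. \<exists>g. pointed_map (Xs (m (Suc k))) (xs (m (Suc k))) (Ys (n k)) (ys (n k)) g \<and>
      pointed_homotopic (Xs (m (Suc k))) (xs (m (Suc k))) (Xs (m k)) (xs (m k)) (f k \<circ> g)
        (structure_map b (m (Suc k)) (m k)) \<and>
      pointed_homotopic (Ys (n (Suc k))) (ys (n (Suc k))) (Ys (n k)) (ys (n k)) (g \<circ> f (Suc k))
        (structure_map c (n (Suc k)) (n k))"
    using z(2) unfolding z_eq N_def prod.case by blast
  from choice[OF this] obtain g where g: "\<And>k. pointed_map (Xs (m (Suc k))) (xs (m (Suc k))) (Ys (n k)) (ys (n k)) (g k)"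
    "\<And>k. pointed_homotopic (Xs (m (Suc k))) (xs (m (Suc k))) (Xs (m k)) (xs (m k)) (f k \<circ> g k)
        (structure_map b (m (Suc k)) (m k))"
    "\<And>k. pointed_homotopic (Ys (n (Suc k))) (ys (n (Suc k))) (Ys (n k)) (ys (n k)) (g k \<circ> f (Suc k))
        (structure_map c (n (Suc k)) (n k))"
    by blast
  have "pointed_system Xs xs b" "pointed_system Ys ys c"
    using X Y by (simp_all add: cw_expansion_def pointed_system_def)
  from interleaving_pi1_sequence[OF this mn f g] show ?thesis by blast
qed

text \<open>An expansion can be transported along a pointed homeomorphism.\<close>

lemma cw_expansion_transport:
  fixes Ys :: "nat \<Rightarrow> 'u topology"
  assumes Y: "cw_expansion Y y Ys ys c q" and x: "x \<in> topspace X" and y: "y \<in> topspace Y"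
    and h: "pointed_map X x Y y h" and h': "pointed_map Y y X x h'"
    and h'h: "\<And>z. z \<in> topspace X \<Longrightarrow> h' (h z) = z" and hh': "\<And>z. z \<in> topspace Y \<Longrightarrow> h (h' z) = z"
  shows "cw_expansion X x Ys ys c (\<lambda>i. q i \<circ> h)"
  unfolding cw_expansion_def
proof (intro conjI allI impI; (elim conjE)?)
  fix i
  show "cw_complex (Ys i)" "ys i \<in> topspace (Ys i)"
    "pointed_map (Ys (Suc i)) (ys (Suc i)) (Ys i) (ys i) (c i)"
    using Y by (simp_all add: cw_expansion_def)
  show "pointed_map X x (Ys i) (ys i) (q i \<circ> h)"
    by (rule pointed_map_compose[OF h]) (use Y in \<open>simp add: cw_expansion_def\<close>)
  have "pointed_homotopic Y y (Ys i) (ys i) (c i \<circ> q (Suc i)) (q i)"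
    using Y by (simp add: cw_expansion_def)
  from pointed_homotopic_compose_right[OF this h]
  show "pointed_homotopic X x (Ys i) (ys i) (c i \<circ> (q (Suc i) \<circ> h)) (q i \<circ> h)"
    by (simp add: comp_assoc)
next
  fix P :: "'u topology" and w f assume P: "cw_complex P" "w \<in> topspace P" and f: "pointed_map X x P w f"
  obtain i g where g: "pointed_map (Ys i) (ys i) P w g"
    "pointed_homotopic Y y P w (g \<circ> q i) (f \<circ> h')"
    using cw_expansion_factor[OF Y P pointed_map_compose[OF h' f]] by blast
  have "pointed_homotopic X x P w f (f \<circ> h' \<circ> h)"
    by (rule pointed_homotopic_equal[OF f x]) (simp add: h'h)
  from pointed_homotopic_trans[OF pointed_homotopic_compose_right[OF g(2) h] pointed_homotopic_sym[OF this]]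
  have "pointed_homotopic X x P w (g \<circ> (q i \<circ> h)) f"
    by (simp add: comp_assoc)
  with g(1) show "\<exists>i g. pointed_map (Ys i) (ys i) P w g \<and> pointed_homotopic X x P w (g \<circ> (q i \<circ> h)) f"
    by blast
next
  fix P :: "'u topology" and w i g k
  assume P: "cw_complex P" "w \<in> topspace P" and g: "pointed_map (Ys i) (ys i) P w g"
    and k: "pointed_map (Ys i) (ys i) P w k"
    and gk: "pointed_homotopic X x P w (g \<circ> (q i \<circ> h)) (k \<circ> (q i \<circ> h))"
  have q: "pointed_map Y y (Ys i) (ys i) (q i)" using Y by (simp add: cw_expansion_def)
  have eq: "pointed_homotopic Y y P w (l \<circ> q i) (l \<circ> (q i \<circ> h) \<circ> h')"
    if l: "pointed_map (Ys i) (ys i) P w l" for l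
    by (rule pointed_homotopic_equal[OF pointed_map_compose[OF q l] y]) (simp add: hh')
  from pointed_homotopic_trans[OF pointed_homotopic_trans[OF eq[OF g]
        pointed_homotopic_compose_right[OF gk h']] pointed_homotopic_sym[OF eq[OF k]]]
  have "pointed_homotopic Y y P w (g \<circ> q i) (k \<circ> q i)" .
  from cw_expansion_unique[OF Y P g k this]
  show "\<exists>i'\<ge>i. pointed_homotopic (Ys i') (ys i') P w
      (g \<circ> structure_map c i' i) (k \<circ> structure_map c i' i)" .
qed

theorem pro_pi1_invariant:
  fixes P1 P2 :: "(real \<Rightarrow> 'u) set pro_group"
  assumes "is_pro_pi1 X x P1" "is_pro_pi1 Y y P2"
    and "x \<in> topspace X" "y \<in> topspace Y"
    and "pointed_map X x Y y h" "pointed_map Y y X x h'"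
    and "\<And>z. z \<in> topspace X \<Longrightarrow> h' (h z) = z" "\<And>z. z \<in> topspace Y \<Longrightarrow> h (h' z) = z"
  shows "pro_equivalent P1 P2" "inverse_limit P1 \<cong> inverse_limit P2"
proof -
  obtain Xs xs b p where X: "cw_expansion X x Xs xs b p" "P1 = pi1_sequence Xs xs b"
    using assms(1) unfolding is_pro_pi1_def by blast
  obtain Ys ys c q where Y: "cw_expansion Y y Ys ys c q" "P2 = pi1_sequence Ys ys c"
    using assms(2) unfolding is_pro_pi1_def by blast
  have sys: "inverse_system P1" "inverse_system P2"
    using X Y by (auto intro!: inverse_system_pi1_sequence simp: cw_expansion_def pointed_system_def)
  obtain m n \<alpha> \<beta> where "interleaving P1 P2 m n \<alpha> \<beta>"
    using cw_expansions_interleave[OF X(1) cw_expansion_transport[OF Y(1) assms(3-8)]]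
    unfolding X(2) Y(2) by blast
  then show "pro_equivalent P1 P2" "inverse_limit P1 \<cong> inverse_limit P2"
    using interleaving_imp_pro_equivalent[OF sys] interleaving_imp_inverse_limit_iso[OF sys] by blast+
qed

section \<open>Euclidean motions and agreement of tilings on balls\<close>

text \<open>The action on single tiles; \<^const>\<open>move\<close> is its image map and keeps the labels.\<close>

definition move_tile :: "'n::finite motion \<Rightarrow> ('n, 'l) tile \<Rightarrow> ('n, 'l) tile" where
  "move_tile \<Phi> t = (\<Phi> ` fst t, snd t)"

lemma move_eq: "move \<Phi> P = move_tile \<Phi> ` P"
  by (force simp: move_def move_tile_def)

lemma fst_move_tile [simp]: "fst (move_tile \<Phi> t) = \<Phi> ` fst t"
  by (simp add: move_tile_def)

lemma move_tile_comp: "move_tile \<Phi> (move_tile \<Psi> t) = move_tile (\<Phi> \<circ> \<Psi>) t"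
  by (simp add: move_tile_def image_comp)

lemma move_comp: "move \<Phi> (move \<Psi> P) = move (\<Phi> \<circ> \<Psi>) P"
  by (simp add: move_eq image_image move_tile_comp)

lemma move_id [simp]: "move id P = P" "move (\<lambda>x. x) P = P"
  by (auto simp: move_eq move_tile_def)

lemma move_zero [simp]: "move ((+) 0) P = P"
  by (simp add: move_eq move_tile_def)

lemma translation_comp: "(+) v \<circ> (+) w = (+) (v + w :: 'a::ab_semigroup_add)"
  by (simp add: fun_eq_iff add.assoc)

lemma move_mono: "P \<subseteq> Q \<Longrightarrow> move \<Phi> P \<subseteq> move \<Phi> Q"
  by (auto simp: move_eq)

text \<open>The motions whose linear part lies in \<open>A\<close>.\<close>

definition motions :: "'n::finite motion set \<Rightarrow> 'n motion set" where
  "motions A = {\<Phi>. \<exists>g\<in>A. \<exists>v. \<Phi> = (\<lambda>y. g y + v)}"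

lemma motions_mono: "A \<subseteq> B \<Longrightarrow> \<Phi> \<in> motions A \<Longrightarrow> \<Phi> \<in> motions B"
  by (auto simp: motions_def)

lemma orthogonal_maps_iff: "g \<in> orthogonal_maps \<longleftrightarrow> orthogonal_transformation g"
  by (simp add: orthogonal_maps_def)

lemma linear_in_motions: "g \<in> A \<Longrightarrow> g \<in> motions A"
  unfolding motions_def by (auto intro!: bexI[of _ g] exI[of _ 0])

lemma translation_in_motions: "id \<in> A \<Longrightarrow> (+) v \<in> motions A"
  unfolding motions_def by (auto intro!: bexI[of _ id] exI[of _ v] simp: fun_eq_iff)

lemma id_in_orthogonal_maps [simp]: "id \<in> orthogonal_maps"
  by (simp add: orthogonal_maps_iff id_def)

lemma translation_motion [simp]: "(+) v \<in> motions orthogonal_maps"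
  by (rule translation_in_motions) simp

lemma motions_translate:
  assumes "A \<subseteq> orthogonal_maps" "\<Phi> \<in> motions A"
  shows "(+) u \<circ> \<Phi> \<circ> (+) w \<in> motions A"
proof -
  obtain g v where g: "g \<in> A" "\<Phi> = (\<lambda>y. g y + v)" using assms(2) by (auto simp: motions_def)
  have "linear g" using assms(1) g(1) by (auto simp: orthogonal_maps_iff orthogonal_transformation_linear)
  then have "(+) u \<circ> \<Phi> \<circ> (+) w = (\<lambda>y. g y + (u + g w + v))"
    by (auto simp: g(2) linear_add)
  then show ?thesis using g(1) by (auto simp: motions_def)
qed

lemma motion_comp:
  assumes "A \<subseteq> orthogonal_maps" "\<And>g h. g \<in> A \<Longrightarrow> h \<in> A \<Longrightarrow> g \<circ> h \<in> A"
    and "\<Phi> \<in> motions A" "\<Psi> \<in> motions A"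
  shows "\<Phi> \<circ> \<Psi> \<in> motions A"
proof -
  obtain g v where g: "g \<in> A" "\<Phi> = (\<lambda>y. g y + v)" using assms(3) by (auto simp: motions_def)
  obtain h w where h: "h \<in> A" "\<Psi> = (\<lambda>y. h y + w)" using assms(4) by (auto simp: motions_def)
  have "linear g" using assms(1) g(1) by (auto simp: orthogonal_maps_iff orthogonal_transformation_linear)
  then have "\<Phi> \<circ> \<Psi> = (\<lambda>y. (g \<circ> h) y + (g w + v))"
    by (auto simp: g(2) h(2) linear_add)
  then show ?thesis using assms(2)[OF g(1) h(1)] unfolding motions_def by blast
qed

lemma motion_inverse:
  assumes "A \<subseteq> orthogonal_maps" "\<And>g. g \<in> A \<Longrightarrow> inv_into UNIV g \<in> A" and "\<Phi> \<in> motions A"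
  obtains \<Psi> where "\<Psi> \<in> motions A" "\<Psi> \<circ> \<Phi> = id" "\<Phi> \<circ> \<Psi> = id"
proof -
  obtain g v where g: "g \<in> A" "\<Phi> = (\<lambda>y. g y + v)" using assms(3) by (auto simp: motions_def)
  have o: "orthogonal_transformation g" using assms(1) g(1) by (auto simp: orthogonal_maps_iff)
  have b: "bij g" by (rule orthogonal_transformation_bij[OF o])
  let ?\<Psi> = "\<lambda>y. inv_into UNIV g y + inv_into UNIV g (- v)"
  have l: "linear (inv_into UNIV g)"
    by (rule orthogonal_transformation_linear[OF orthogonal_transformation_inv[OF o]])
  have "?\<Psi> (\<Phi> y) = y" for y
    using b by (simp add: g(2) linear_add[OF l, symmetric] bij_is_inj)
  moreover have "\<Phi> (?\<Psi> y) = y" for y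
    using b by (simp add: g(2) linear_add[OF l, symmetric] bij_is_surj surj_f_inv_f)
  ultimately show thesis
    using assms(2)[OF g(1)] by (intro that[of ?\<Psi>]) (auto simp: motions_def fun_eq_iff)
qed

lemma orthogonal_maps_closed:
  "g \<in> orthogonal_maps \<Longrightarrow> h \<in> orthogonal_maps \<Longrightarrow> g \<circ> h \<in> orthogonal_maps"
  "g \<in> orthogonal_maps \<Longrightarrow> inv_into UNIV g \<in> orthogonal_maps"
  by (auto simp: orthogonal_maps_iff orthogonal_transformation_compose orthogonal_transformation_inv)

lemma rotations_subset: "rotations \<subseteq> orthogonal_maps"
  by (auto simp: rotations_def)

lemma det_compose:
  assumes "g \<in> orthogonal_maps" "h \<in> orthogonal_maps"
  shows "det (matrix (g \<circ> h)) = det (matrix g) * det (matrix h)"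
  using assms by (simp add: matrix_compose orthogonal_maps_iff orthogonal_transformation_linear det_mul)

lemma det_inv:
  assumes "g \<in> orthogonal_maps"
  shows "det (matrix (inv_into UNIV g)) * det (matrix g) = 1"
proof -
  have "inv_into UNIV g \<circ> g = id"
    using assms by (simp add: orthogonal_maps_iff orthogonal_transformation_inj)
  then have "det (matrix (inv_into UNIV g)) * det (matrix g) = det (matrix (id :: 'a motion))"
    using det_compose[OF orthogonal_maps_closed(2)[OF assms] assms] by simp
  then show ?thesis by (simp add: matrix_id_mat_1)
qed

lemma rotations_closed:
  "id \<in> rotations"
  "g \<in> rotations \<Longrightarrow> h \<in> rotations \<Longrightarrow> g \<circ> h \<in> rotations"
  "g \<in> rotations \<Longrightarrow> inv_into UNIV g \<in> rotations"
  using det_compose[of g h] det_inv[of g]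
  by (auto simp: rotations_def orthogonal_maps_closed matrix_id_mat_1)

lemma reflections_comp:
  assumes "g \<in> orthogonal_maps - rotations" "h \<in> orthogonal_maps - rotations"
  shows "g \<circ> h \<in> rotations"
proof -
  have "det (matrix k) = -1" if "k \<in> orthogonal_maps - rotations" for k :: "'a motion"
    using that orthogonal_transformation_det[of k] by (auto simp: rotations_def orthogonal_maps_iff abs_if split: if_splits)
  from this[OF assms(1)] this[OF assms(2)] have "det (matrix (g \<circ> h)) = 1"
    using assms by (subst det_compose) auto
  with assms show ?thesis
    unfolding rotations_def by (simp add: orthogonal_maps_closed)
qed

context
  fixes \<Phi> :: "'n::finite motion"
  assumes \<Phi>: "\<Phi> \<in> motions orthogonal_maps"
begin

lemma motion_dist: "dist (\<Phi> x) (\<Phi> y) = dist x y"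
proof -
  obtain g v where g: "orthogonal_transformation g" "\<Phi> = (\<lambda>y. g y + v)"
    using \<Phi> by (auto simp: motions_def orthogonal_maps_iff)
  have "\<Phi> x - \<Phi> y = g (x - y)"
    by (simp add: g(2) linear_diff[OF orthogonal_transformation_linear[OF g(1)]])
  then show ?thesis by (simp add: dist_norm orthogonal_transformation_norm[OF g(1)])
qed

lemma motion_bij: "bij \<Phi>"
  using motion_inverse[OF order_refl orthogonal_maps_closed(2) \<Phi>] o_bij by metis

lemma motion_image_cball: "\<Phi> ` cball x r = cball (\<Phi> x) r"
proof (intro equalityI subsetI)
  fix y assume y: "y \<in> cball (\<Phi> x) r"
  obtain z where "y = \<Phi> z" using motion_bij by (metis bij_pointE)
  with y show "y \<in> \<Phi> ` cball x r" by (auto simp: motion_dist)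
qed (auto simp: motion_dist)

lemma inj_move_tile: "inj (move_tile \<Phi>)"
proof (rule injI)
  fix s t :: "('n, 'l) tile" assume "move_tile \<Phi> s = move_tile \<Phi> t"
  then show "s = t"
    using inj_image_eq_iff[OF bij_is_inj[OF motion_bij]] by (auto simp: move_tile_def prod_eq_iff)
qed

lemma r_patch_move: "r_patch (move \<Phi> T) (\<Phi> y) R = move \<Phi> (r_patch T y R)"
proof -
  have "\<Phi> ` S \<inter> cball (\<Phi> y) R \<noteq> {} \<longleftrightarrow> S \<inter> cball y R \<noteq> {}" for S
    unfolding motion_image_cball[symmetric] image_Int[OF bij_is_inj[OF motion_bij], symmetric] by simp
  moreover have "{t \<in> move_tile \<Phi> ` T. P t} = move_tile \<Phi> ` {t \<in> T. P (move_tile \<Phi> t)}" for P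
    by blast
  ultimately show ?thesis
    by (simp add: r_patch_def move_eq)
qed

lemma move_eq_iff: "move \<Phi> P = move \<Phi> Q \<longleftrightarrow> P = Q"
  unfolding move_eq by (rule inj_image_eq_iff[OF inj_move_tile])

end

text \<open>\<open>agree T S y R\<close>: the tilings have the same tiles in the closed ball of radius \<open>R\<close> at \<open>y\<close>. For \<open>R < 0\<close> the
  ball is empty and the condition always holds, so that radii may be decreased freely.\<close>

definition agree :: "('n::finite, 'l) tiling \<Rightarrow> ('n, 'l) tiling \<Rightarrow> real ^ 'n \<Rightarrow> real \<Rightarrow> bool" where
  "agree T S y R \<longleftrightarrow> r_patch T y R = r_patch S y R"

lemma agree_iff:
  "agree T S y R \<longleftrightarrow> (\<forall>t. fst t \<inter> cball y R \<noteq> {} \<longrightarrow> (t \<in> T \<longleftrightarrow> t \<in> S))"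
  unfolding agree_def r_patch_def set_eq_iff mem_Collect_eq by blast

lemma agree_refl [simp]: "agree T T y R"
  by (simp add: agree_def)

lemma agree_sym: "agree T S y R \<Longrightarrow> agree S T y R"
  by (simp add: agree_def)

lemma agree_trans: "agree T S y R \<Longrightarrow> agree S U y R \<Longrightarrow> agree T U y R"
  by (simp add: agree_def)

lemma agree_mono:
  assumes "agree T S y R" "dist z y + r \<le> R"
  shows "agree T S z r"
proof -
  have "cball z r \<subseteq> cball y R"
    using assms(2) by (auto intro: order_trans[OF dist_triangle[of _ _ z]] simp: dist_commute)
      (smt (verit) dist_commute dist_triangle)
  then show ?thesis using assms(1) unfolding agree_iff by blast
qed

text \<open>A tile that meets a ball meets a small ball about one of its points.\<close>

lemma agree_cover:
  assumes "\<And>p. p \<in> cball y R \<Longrightarrow> agree T S p 1"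
  shows "agree T S y R"
  unfolding agree_iff
proof (intro allI impI)
  fix t :: "('a, 'b) tile" assume "fst t \<inter> cball y R \<noteq> {}"
  then obtain p where p: "p \<in> fst t" "p \<in> cball y R" by blast
  then have "fst t \<inter> cball p 1 \<noteq> {}" by auto
  with assms[OF p(2)] show "t \<in> T \<longleftrightarrow> t \<in> S" unfolding agree_iff by blast
qed

lemma agree_move:
  assumes "\<Phi> \<in> motions orthogonal_maps"
  shows "agree (move \<Phi> T) (move \<Phi> S) (\<Phi> y) R \<longleftrightarrow> agree T S y R"
  by (simp add: agree_def r_patch_move[OF assms] move_eq_iff[OF assms])

lemma agree_translate:
  "agree (move ((+) v) T) S z R \<longleftrightarrow> agree T (move ((+) (- v)) S) (z - v) R"
  using agree_move[of "(+) (- v)" "move ((+) v) T" S z R]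
  by (simp add: move_comp comp_def)

text \<open>Without empty tiles, every tile meets some ball and is seen by \<^const>\<open>agree\<close>.\<close>

definition proper :: "('n::finite, 'l) tiling \<Rightarrow> bool" where
  "proper T \<longleftrightarrow> (\<forall>t\<in>T. fst t \<noteq> {})"

lemma agree_everywhere:
  assumes "proper T" "proper S" "\<And>R. agree T S y R"
  shows "T = S"
proof -
  have "t \<in> T \<longleftrightarrow> t \<in> S" if ne: "fst t \<noteq> {}" for t
  proof -
    obtain p where "p \<in> fst t" using ne by blast
    then have "fst t \<inter> cball y (dist y p) \<noteq> {}" by auto
    with assms(3) show ?thesis unfolding agree_iff by blast
  qed
  then show ?thesis using assms(1,2) unfolding proper_def by blast
qed

section \<open>Patches of tilings and the hull\<close>

lemma polyhedral_body_compact: "polyhedral_body S \<Longrightarrow> compact S"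
  unfolding polyhedral_body_def by (metis compact_Union polytope_imp_compact)

lemma polyhedral_body_subset_closure_interior:
  assumes "polyhedral_body S" shows "S \<subseteq> closure (interior S)"
proof
  fix x assume "x \<in> S"
  obtain \<P> where \<P>: "S = \<Union>\<P>" "\<forall>C\<in>\<P>. polytope C \<and> interior C \<noteq> {}"
    using assms by (auto simp: polyhedral_body_def)
  then obtain C where C: "x \<in> C" "C \<in> \<P>" using \<open>x \<in> S\<close> by blast
  then have "C \<subseteq> closure (interior C)"
    using \<P>(2) convex_closure_interior[of C] closure_subset[of C] by (simp add: polytope_imp_convex)
  moreover have "closure (interior C) \<subseteq> closure (interior S)"
    using C(2) \<P>(1) by (intro closure_mono interior_mono) blast
  ultimately show "x \<in> closure (interior S)" using C(1) by blast
qed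

lemma polyhedral_body_interior_nonempty: "polyhedral_body S \<Longrightarrow> interior S \<noteq> {}"
  unfolding polyhedral_body_def using interior_mono[OF Union_upper] by (metis ex_in_conv subset_empty)

context
  fixes T :: "('n::finite, 'l) tiling"
  assumes T: "is_tiling T"
begin

lemma tiling_body: "t \<in> T \<Longrightarrow> polyhedral_body (fst t)"
  using T by (simp add: is_tiling_def)

lemma tiling_cover: "\<exists>t\<in>T. p \<in> fst t"
proof -
  have "p \<in> (\<Union>t\<in>T. fst t)" using T unfolding is_tiling_def by simp
  then show ?thesis by simp
qed

lemma tiling_faces:
  assumes "s \<in> T" "t \<in> T" "s \<noteq> t"
  shows "fst s \<inter> fst t \<subseteq> frontier (fst s) \<inter> frontier (fst t)"
    "fst s \<inter> fst t = \<Union>(faces (fst s) \<inter> faces (fst t))"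
proof -
  note * = T[unfolded is_tiling_def, THEN conjunct2, THEN conjunct2, THEN conjunct1, rule_format, OF assms]
  show "fst s \<inter> fst t \<subseteq> frontier (fst s) \<inter> frontier (fst t)" by (rule conjunct1[OF *])
  show "fst s \<inter> fst t = \<Union>(faces (fst s) \<inter> faces (fst t))" by (rule conjunct2[OF *])
qed

lemma tiling_prototiles:
  obtains F where "finite F" "\<And>t. t \<in> T \<Longrightarrow> \<exists>p\<in>F. \<exists>v. t = move_tile ((+) v) p"
  using T[unfolded is_tiling_def, THEN conjunct2, THEN conjunct2, THEN conjunct2, THEN conjunct1]
  by (auto simp: move_eq)

lemma tiling_finite_complexity:
  obtains \<Q> where "finite \<Q>" "\<And>x. \<exists>Q\<in>\<Q>. \<exists>v. r_patch T x r = move ((+) v) Q"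
proof -
  have "\<exists>\<Q>. finite \<Q> \<and> (\<forall>x. \<exists>Q\<in>\<Q>. \<exists>v. r_patch T x r = move ((+) v) Q)"
    using T unfolding is_tiling_def by simp
  then show thesis using that by blast
qed

lemma tiling_proper: "proper T"
  unfolding proper_def using tiling_body polyhedral_body_interior_nonempty interior_subset by blast

lemma tiling_interior:
  assumes "s \<in> T" "t \<in> T" "p \<in> fst s" "p \<in> interior (fst t)"
  shows "s = t"
proof (rule ccontr)
  assume "s \<noteq> t"
  have "p \<in> fst s \<inter> fst t" using assms(3,4) interior_subset by blast
  with tiling_faces(1)[OF assms(1,2) \<open>s \<noteq> t\<close>] have "p \<in> frontier (fst t)" by blast
  then show False using assms(4) by (simp add: frontier_def)
qed

text \<open>Distinct translates of \<open>p\<close> in \<open>T\<close> have disjoint interiors. As \<open>p\<close> contains a ball of some radius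
  \<open>e\<close>, the translation vectors are \<open>e\<close>-separated, and they are bounded for tiles meeting a given ball.\<close>

lemma finite_tiles_of_type: "finite {t \<in> r_patch T x r. \<exists>v. t = move_tile ((+) v) p}"
  (is "finite ?K")
proof (cases "?K = {}")
  case False
  then obtain t0 v0 where t0: "t0 \<in> T" "t0 = move_tile ((+) v0) p"
    by (auto simp: r_patch_def)
  have p: "fst p = (+) (- v0) ` fst t0" by (simp add: t0(2) image_image)
  have "compact (fst p)" unfolding p
    by (intro compact_translation polyhedral_body_compact tiling_body t0(1))
  then obtain B where B: "\<And>y. y \<in> fst p \<Longrightarrow> norm y \<le> B"
    using compact_imp_bounded bounded_iff by metis
  have "interior (fst p) \<noteq> {}"
    unfolding p interior_translation using polyhedral_body_interior_nonempty[OF tiling_body[OF t0(1)]] by simp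
  then obtain c e where c: "e > 0" "ball c e \<subseteq> fst p" "c \<in> interior (fst p)"
    by (metis ex_in_conv mem_interior)
  obtain v where v: "\<And>t. t \<in> ?K \<Longrightarrow> t = move_tile ((+) (v t)) p"
    using bchoice[of ?K "\<lambda>t v. t = move_tile ((+) v) p"] by blast
  have "uniform_discrete (v ` ?K)"
  proof (rule uniformI1[OF c(1)], elim imageE)
    fix x y s t assume xy: "dist x y < e" "x = v s" "s \<in> ?K" "y = v t" "t \<in> ?K"
    have "s = t"
    proof (rule tiling_interior)
      show "s \<in> T" "t \<in> T" using xy by (auto simp: r_patch_def)
      have "c + y - x \<in> fst p" using xy(1) c(2) by (auto simp: dist_norm norm_minus_commute algebra_simps)
      then have "x + (c + y - x) \<in> (+) x ` fst p" by blast
      moreover have fst: "fst s = (+) x ` fst p" "fst t = (+) y ` fst p"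
        using arg_cong[OF v[OF xy(3)], of fst] arg_cong[OF v[OF xy(5)], of fst] xy(2,4) by simp_all
      ultimately show "y + c \<in> fst s" by (simp add: add.commute)
      show "y + c \<in> interior (fst t)"
        unfolding fst interior_translation using c(3) by blast
    qed
    then show "x = y" using xy by simp
  qed
  moreover have "bounded (v ` ?K)"
  proof (rule boundedI, elim imageE)
    fix y t assume t: "y = v t" "t \<in> ?K"
    then have "fst t \<inter> cball x r \<noteq> {}" by (simp add: r_patch_def)
    then obtain q where q: "q \<in> fst t" "dist x q \<le> r" by auto
    have "fst t = (+) y ` fst p" using arg_cong[OF v[OF t(2)], of fst] t(1) by simp
    with q(1) obtain q' where q': "q' \<in> fst p" "q = y + q'" by blast
    have "norm y \<le> norm q + norm q'" using norm_triangle_ineq4[of q q'] by (simp add: q'(2))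
    moreover have "norm q \<le> norm x + r" using q(2) norm_triangle_ineq2[of q x] by (simp add: dist_norm norm_minus_commute)
    ultimately show "norm y \<le> norm x + r + B" using B[OF q'(1)] by simp
  qed
  ultimately have "finite (v ` ?K)" using uniform_discrete_finite_iff by blast
  moreover have "?K \<subseteq> (\<lambda>w. move_tile ((+) w) p) ` v ` ?K"
    using v by blast
  ultimately show ?thesis by (meson finite_imageI finite_subset)
next
  case True
  then show ?thesis by (simp only: finite.emptyI)
qed

lemma finite_r_patch: "finite (r_patch T x r)"
proof -
  obtain F where F: "finite F" "\<And>t. t \<in> T \<Longrightarrow> \<exists>p\<in>F. \<exists>v. t = move_tile ((+) v) p"
    using tiling_prototiles by blast
  have "r_patch T x r \<subseteq> (\<Union>p\<in>F. {t \<in> r_patch T x r. \<exists>v. t = move_tile ((+) v) p})"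
    using F(2) unfolding r_patch_def by blast
  then show ?thesis
    by (rule finite_subset) (use F(1) finite_tiles_of_type in auto)
qed

text \<open>Each tile is the closure of its interior. Hence a tile of \<open>T\<close> that meets the smaller ball has
  interior points in the larger ball, where it overlaps a moved tile of \<open>S\<close>.\<close>

lemma agree_of_patch_subset:
  assumes S: "\<And>p. \<exists>s\<in>S. p \<in> fst s" and \<Phi>: "\<Phi> \<in> motions orthogonal_maps"
    and sub: "move \<Phi> (r_patch S y (R + 1)) \<subseteq> T"
  shows "agree (move \<Phi> S) T (\<Phi> y) R"
  unfolding agree_iff
proof (intro allI impI iffI)
  fix t :: "('n, 'l) tile" assume m: "fst t \<inter> cball (\<Phi> y) R \<noteq> {}"
  {
    assume "t \<in> move \<Phi> S"
    then have "t \<in> r_patch (move \<Phi> S) (\<Phi> y) (R + 1)"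
      using m by (auto simp: r_patch_def)
    then show "t \<in> T" using sub by (auto simp: r_patch_move[OF \<Phi>])
  next
    assume t: "t \<in> T"
    obtain p where p: "p \<in> fst t" "dist (\<Phi> y) p \<le> R" using m by auto
    have "p \<in> closure (interior (fst t))"
      using polyhedral_body_subset_closure_interior[OF tiling_body[OF t]] p(1) by blast
    then obtain p' where p': "p' \<in> interior (fst t)" "dist p' p < 1"
      by (meson closure_approachable zero_less_one)
    obtain q where q: "p' = \<Phi> q" using motion_bij[OF \<Phi>] by (metis bij_pointE)
    obtain s where s: "s \<in> S" "q \<in> fst s" using S by blast
    have "dist (\<Phi> y) (\<Phi> q) \<le> R + 1"
      using p(2) p'(2) dist_triangle[of "\<Phi> y" p' p] by (simp add: dist_commute q)
    then have "s \<in> r_patch S y (R + 1)" using s by (auto simp: r_patch_def motion_dist[OF \<Phi>])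
    then have "move_tile \<Phi> s \<in> T" using sub by (auto simp: move_eq)
    moreover have "p' \<in> fst (move_tile \<Phi> s)" using s(2) q by simp
    ultimately have "move_tile \<Phi> s = t" using t p'(1) by (metis tiling_interior)
    then show "t \<in> move \<Phi> S" using s(1) by (auto simp: move_eq)
  }
qed

end

lemma same_germ_translation:
  "same_germ ((+) v ` S) (v + x) (v + y) \<longleftrightarrow> same_germ S x y"
proof -
  have "v + x + u \<in> (+) v ` S \<longleftrightarrow> x + u \<in> S" for x u :: "real ^ 'a"
    by (auto simp: add.assoc)
  then show ?thesis by (simp add: same_germ_def)
qed

lemma faces_translation: "faces ((+) v ` S) = (`) ((+) v) ` faces S"
proof -
  have "closure (connected_component_set {y \<in> (+) v ` S. same_germ ((+) v ` S) (v + x) y} (v + x)) =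
      (+) v ` closure (connected_component_set {y \<in> S. same_germ S x y} x)" if "x \<in> S" for x
  proof -
    let ?A = "{y \<in> S. same_germ S x y}"
    have "{y \<in> (+) v ` S. same_germ ((+) v ` S) (v + x) y} = (+) v ` ?A"
      by (auto simp: same_germ_translation)
    moreover have "homeomorphism ?A ((+) v ` ?A) ((+) v) ((+) (- v))"
      by (auto simp: homeomorphism_def image_image intro!: continuous_intros)
    moreover have "x \<in> ?A" using that by (auto simp: same_germ_def intro: exI[of _ 1])
    ultimately show ?thesis
      by (simp add: connected_component_set_homeomorphism closure_translation)
  qed
  then show ?thesis unfolding faces_def by (auto simp: image_iff)
qed

lemma polyhedral_body_translation:
  assumes "polyhedral_body S" shows "polyhedral_body ((+) v ` S)"
proof -
  obtain \<P> where "finite \<P>" "\<P> \<noteq> {}" "S = \<Union>\<P>" "\<forall>C\<in>\<P>. polytope C \<and> interior C \<noteq> {}"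
    using assms by (auto simp: polyhedral_body_def)
  then show ?thesis
    unfolding polyhedral_body_def
    by (intro exI[of _ "(`) ((+) v) ` \<P>"]) (auto simp: polytope_translation_eq interior_translation)
qed

lemma faces_condition_translation:
  assumes "A \<inter> B \<subseteq> frontier A \<inter> frontier B" "A \<inter> B = \<Union>(faces A \<inter> faces B)"
  shows "(+) v ` A \<inter> (+) v ` B \<subseteq> frontier ((+) v ` A) \<inter> frontier ((+) v ` B)"
    "(+) v ` A \<inter> (+) v ` B = \<Union>(faces ((+) v ` A) \<inter> faces ((+) v ` B))"
proof -
  have i: "inj ((+) v)" "inj ((`) ((+) v))" by (simp_all add: inj_image_eq_iff inj_def)
  show "(+) v ` A \<inter> (+) v ` B \<subseteq> frontier ((+) v ` A) \<inter> frontier ((+) v ` B)"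
    unfolding frontier_translation image_Int[OF i(1), symmetric] by (rule image_mono[OF assms(1)])
  have "\<Union>(faces ((+) v ` A) \<inter> faces ((+) v ` B)) = (+) v ` \<Union>(faces A \<inter> faces B)"
    unfolding faces_translation image_Int[OF i(2), symmetric] by blast
  then show "(+) v ` A \<inter> (+) v ` B = \<Union>(faces ((+) v ` A) \<inter> faces ((+) v ` B))"
    using assms(2) by (simp add: image_Int[OF i(1), symmetric])
qed

text \<open>Being a tiling is a local condition: each requirement concerns a pair of tiles or a single
  patch, hence only a bounded part of \<open>S\<close>, where \<open>S\<close> is a translate of \<open>T\<close>.\<close>

lemma is_tiling_locally:
  assumes T: "is_tiling T" and S: "proper S" "\<And>R. \<exists>v. agree S (move ((+) v) T) 0 R"
  shows "is_tiling S"
proof -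
  have ball: "\<exists>v. agree S (move ((+) v) T) x r" for x r
  proof -
    obtain v where "agree S (move ((+) v) T) 0 (norm x + r)" using S(2) by blast
    then have "agree S (move ((+) v) T) x r" by (rule agree_mono) simp
    then show ?thesis ..
  qed
  have pair: "\<exists>v s' t'. s' \<in> T \<and> t' \<in> T \<and> s = move_tile ((+) v) s' \<and> t = move_tile ((+) v) t'"
    if st: "s \<in> S" "t \<in> S" for s t
  proof -
    obtain p q where pq: "p \<in> fst s" "q \<in> fst t" using st S(1) unfolding proper_def by blast
    obtain v where v: "agree S (move ((+) v) T) 0 (max (norm p) (norm q))" using S(2) by blast
    have "fst s \<inter> cball 0 (max (norm p) (norm q)) \<noteq> {}" "fst t \<inter> cball 0 (max (norm p) (norm q)) \<noteq> {}"
      using pq by auto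
    then have "s \<in> move ((+) v) T" "t \<in> move ((+) v) T" using v st unfolding agree_iff by blast+
    then show ?thesis unfolding move_eq by blast
  qed
  have body: "polyhedral_body (fst t)" if t: "t \<in> S" for t
  proof -
    obtain v t' where "t' \<in> T" "t = move_tile ((+) v) t'" using pair[OF t t] by blast
    then show ?thesis using polyhedral_body_translation[OF tiling_body[OF T]] by simp
  qed
  have cover: "\<exists>t\<in>S. p \<in> fst t" for p
  proof -
    obtain v where v: "agree S (move ((+) v) T) p 1" using ball by blast
    obtain t where t: "t \<in> T" "p - v \<in> fst t" using tiling_cover[OF T] by blast
    have p: "p \<in> fst (move_tile ((+) v) t)" using t(2) by (auto simp: image_iff algebra_simps intro!: bexI[of _ "p - v"])
    then have "fst (move_tile ((+) v) t) \<inter> cball p 1 \<noteq> {}" by force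
    moreover have "move_tile ((+) v) t \<in> move ((+) v) T" using t(1) by (auto simp: move_eq)
    ultimately show ?thesis using v p unfolding agree_iff by blast
  qed
  have face: "fst s \<inter> fst t \<subseteq> frontier (fst s) \<inter> frontier (fst t)"
    "fst s \<inter> fst t = \<Union>(faces (fst s) \<inter> faces (fst t))"
    if st: "s \<in> S" "t \<in> S" "s \<noteq> t" for s t
  proof -
    obtain v s' t' where h: "s' \<in> T" "t' \<in> T" "s = move_tile ((+) v) s'" "t = move_tile ((+) v) t'"
      using pair[OF st(1,2)] by blast
    then have "s' \<noteq> t'" using st(3) by blast
    from faces_condition_translation[OF tiling_faces[OF T h(1,2) this]]
    show "fst s \<inter> fst t \<subseteq> frontier (fst s) \<inter> frontier (fst t)"
      "fst s \<inter> fst t = \<Union>(faces (fst s) \<inter> faces (fst t))" by (simp_all add: h(3,4))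
  qed
  have prototiles: "\<exists>F. finite F \<and> (\<forall>t\<in>S. \<exists>p\<in>F. \<exists>v. {t} = move ((+) v) {p})"
  proof -
    obtain F where F: "finite F" "\<And>t. t \<in> T \<Longrightarrow> \<exists>p\<in>F. \<exists>v. t = move_tile ((+) v) p"
      using tiling_prototiles[OF T] by blast
    have "\<exists>p\<in>F. \<exists>v. {t} = move ((+) v) {p}" if t: "t \<in> S" for t
    proof -
      obtain v t' where t': "t' \<in> T" "t = move_tile ((+) v) t'" using pair[OF t t] by blast
      obtain p w where p: "p \<in> F" "t' = move_tile ((+) w) p" using F(2)[OF t'(1)] by blast
      have "{t} = move ((+) (v + w)) {p}"
        by (simp add: t'(2) p(2) move_eq move_tile_comp translation_comp)
      then show ?thesis using p(1) by blast
    qed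
    with F(1) show ?thesis by blast
  qed
  have complexity: "\<exists>\<Q>. finite \<Q> \<and> (\<forall>x. \<exists>Q\<in>\<Q>. \<exists>v. r_patch S x r = move ((+) v) Q)" for r
  proof -
    obtain \<Q> where \<Q>: "finite \<Q>" "\<And>x. \<exists>Q\<in>\<Q>. \<exists>v. r_patch T x r = move ((+) v) Q"
      using tiling_finite_complexity[OF T] by blast
    have "\<exists>Q\<in>\<Q>. \<exists>v. r_patch S x r = move ((+) v) Q" for x
    proof -
      obtain v where v: "agree S (move ((+) v) T) x r" using ball by blast
      obtain Q w where Q: "Q \<in> \<Q>" "r_patch T (x - v) r = move ((+) w) Q" using \<Q>(2) by blast
      have "r_patch S x r = move ((+) v) (r_patch T (x - v) r)"
        using v r_patch_move[of "(+) v" T "x - v" r] by (simp add: agree_def)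
      also have "\<dots> = move ((+) (v + w)) Q" by (simp add: Q(2) move_comp translation_comp)
      finally show ?thesis using Q(1) by blast
    qed
    with \<Q>(1) show ?thesis by blast
  qed
  show ?thesis
    unfolding is_tiling_def
    by (intro conjI ballI allI impI body face prototiles complexity) (use cover in auto)
qed

text \<open>The hull consists of those sets of nonempty tiles that agree with a translate of \<open>T\<close> on every
  ball about the origin.\<close>

proposition tiling_hull_iff:
  assumes T: "is_tiling T"
  shows "S \<in> tiling_hull T \<longleftrightarrow> proper S \<and> (\<forall>R. \<exists>v. agree S (move ((+) v) T) 0 R)"
proof (intro iffI conjI allI)
  assume S: "S \<in> tiling_hull T"
  then have tS: "is_tiling S" by (simp add: tiling_hull_def)
  then show "proper S" by (rule tiling_proper)
  fix R
  have "finite (r_patch S 0 (R + 1))" "r_patch S 0 (R + 1) \<subseteq> S"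
    using finite_r_patch[OF tS] by (auto simp: r_patch_def)
  with S have "appears_in (r_patch S 0 (R + 1)) T" by (simp add: tiling_hull_def)
  then obtain w where "move ((+) w) (r_patch S 0 (R + 1)) \<subseteq> T"
    by (auto simp: appears_in_def)
  from agree_of_patch_subset[OF T tiling_cover[OF tS] translation_motion this]
  show "\<exists>v. agree S (move ((+) v) T) 0 R" by (auto simp: agree_translate)
next
  assume S: "proper S \<and> (\<forall>R. \<exists>v. agree S (move ((+) v) T) 0 R)"
  have "appears_in P T" if P: "finite P" "P \<subseteq> S" for P
  proof -
    have "\<forall>t\<in>P. \<exists>p. p \<in> fst t" using P(2) S by (auto simp: proper_def)
    then obtain p where p: "\<And>t. t \<in> P \<Longrightarrow> p t \<in> fst t" by metis
    define R where "R = (\<Sum>t\<in>P. norm (p t))"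
    obtain v where v: "agree S (move ((+) v) T) 0 R" using S by blast
    have "P \<subseteq> move ((+) v) T"
    proof
      fix t assume t: "t \<in> P"
      have "norm (p t) \<le> R" unfolding R_def using P(1) t by (intro member_le_sum) auto
      then have "fst t \<inter> cball 0 R \<noteq> {}" using p[OF t] by auto
      then show "t \<in> move ((+) v) T" using v t P(2) unfolding agree_iff by blast
    qed
    then have "move ((+) (- v)) P \<subseteq> move ((+) (- v)) (move ((+) v) T)" by (rule move_mono)
    then show ?thesis by (auto simp: appears_in_def move_comp comp_def)
  qed
  moreover have "is_tiling S" by (rule is_tiling_locally[OF T]) (use S in auto)
  ultimately show "S \<in> tiling_hull T" by (simp add: tiling_hull_def)
qed

lemma tiling_in_hull: "is_tiling T \<Longrightarrow> T \<in> tiling_hull T"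
  by (auto simp: tiling_hull_iff tiling_proper intro!: exI[of _ 0])

lemma hull_is_tiling: "S \<in> tiling_hull T \<Longrightarrow> is_tiling S"
  by (simp add: tiling_hull_def)

lemma hull_local:
  assumes "is_tiling T" "S \<in> tiling_hull T"
  obtains v where "agree S (move ((+) v) T) y R"
proof -
  obtain v where "agree S (move ((+) v) T) 0 (norm y + R)"
    using assms by (auto simp: tiling_hull_iff)
  then have "agree S (move ((+) v) T) y R" by (rule agree_mono) simp
  then show thesis by (rule that)
qed

text \<open>A rotation or reflection that acts on \<open>T\<close> maps patches of hull elements
  to patches of \<open>T\<close> up to translation.\<close>

lemma acts_on_agree:
  assumes T: "is_tiling T" and g: "g \<in> orthogonal_maps" "acts_on g T" and S: "S \<in> tiling_hull T"
  obtains v where "agree (move g S) (move ((+) v) T) 0 R"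
proof -
  note tS = hull_is_tiling[OF S]
  have g0: "g 0 = 0" and lin: "linear g"
    using g(1) by (auto simp: orthogonal_maps_iff orthogonal_transformation_linear linear_0)
  have "appears_in (r_patch S 0 (R + 1)) T"
    using S finite_r_patch[OF tS] by (auto simp: tiling_hull_def r_patch_def)
  then obtain u where u: "move ((+) u) (r_patch S 0 (R + 1)) \<subseteq> T" by (auto simp: appears_in_def)
  have "finite (move ((+) u) (r_patch S 0 (R + 1)))"
    using finite_r_patch[OF tS] by (simp add: move_eq)
  with g(2) u obtain w where "move ((+) w) (move g (move ((+) u) (r_patch S 0 (R + 1)))) \<subseteq> T"
    unfolding acts_on_def appears_in_def by blast
  moreover have "(+) w \<circ> g \<circ> (+) u = (+) (w + g u) \<circ> g"
    using lin by (auto simp: linear_add)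
  ultimately have sub: "move ((+) (w + g u) \<circ> g) (r_patch S 0 (R + 1)) \<subseteq> T"
    by (simp add: move_comp comp_assoc)
  have "(+) (w + g u) \<circ> g \<circ> (+) 0 \<in> motions orthogonal_maps"
    by (intro motions_translate linear_in_motions g(1)) simp
  then have "(+) (w + g u) \<circ> g \<in> motions orthogonal_maps" by (simp add: comp_def)
  from agree_of_patch_subset[OF T tiling_cover[OF tS] this sub]
  have "agree (move ((+) (w + g u)) (move g S)) T (w + g u) R"
    by (simp add: move_comp g0)
  then have "agree (move g S) (move ((+) (- (w + g u))) T) 0 R"
    by (simp add: agree_translate)
  then show thesis by (rule that)
qed

lemma hull_move:
  assumes "is_tiling T" "g \<in> orthogonal_maps" "acts_on g T" "S \<in> tiling_hull T"
  shows "move g S \<in> tiling_hull T"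
  unfolding tiling_hull_iff[OF assms(1)]
proof (intro conjI allI)
  show "proper (move g S)"
    using tiling_proper[OF hull_is_tiling[OF assms(4)]] by (auto simp: proper_def move_eq)
  show "\<exists>v. agree (move g S) (move ((+) v) T) 0 R" for R
    using acts_on_agree[OF assms] by blast
qed

lemma acts_on_iff_hull:
  assumes "is_tiling T" "g \<in> orthogonal_maps"
  shows "acts_on g T \<longleftrightarrow> move g T \<in> tiling_hull T"
proof
  assume gT: "move g T \<in> tiling_hull T"
  show "acts_on g T"
    unfolding acts_on_def
  proof (intro allI impI)
    fix P :: "('a, 'b) tile set" assume "finite P \<and> P \<subseteq> T"
    then have "finite (move g P)" "move g P \<subseteq> move g T" by (auto simp: move_eq)
    then show "appears_in (move g P) T" using gT by (simp add: tiling_hull_def)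
  qed
next
  assume "acts_on g T"
  then show "move g T \<in> tiling_hull T" by (intro hull_move assms tiling_in_hull)
qed

section \<open>The map of hulls induced by a local derivation\<close>

text \<open>The tiling derived from a hull element \<open>S\<close> of \<open>T1\<close>: wherever \<open>S\<close> looks like a translate of
  \<open>T1\<close> in a ball of radius \<open>r\<close>, it has the tiles that the same translate of \<open>T2\<close> has there.\<close>

definition derived_tiling ::
  "real \<Rightarrow> ('n::finite, 'l) tiling \<Rightarrow> ('n, 'k) tiling \<Rightarrow> ('n, 'l) tiling \<Rightarrow> ('n, 'k) tiling" where
  "derived_tiling r T1 T2 S =
     {t. \<exists>v z. agree (move ((+) v) T1) S z r \<and> t \<in> r_patch (move ((+) v) T2) z 1}"

text \<open>Local derivability of \<open>T2\<close> from \<open>T1\<close> with radius \<open>r\<close>, respecting the motions with linear part in \<open>A\<close>.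
  A motion that identifies a patch of \<open>T1\<close> at one point with the patch at another is expressed by the
  agreement of the moved tiling with \<open>T1\<close> at the second point. The set \<open>A\<close> need not be a group.\<close>

locale local_derivation =
  fixes T1 :: "('n::finite, 'l) tiling" and T2 :: "('n, 'k) tiling"
    and A :: "'n motion set" and r :: real
  assumes T1: "is_tiling T1" and T2: "is_tiling T2"
    and A: "A \<subseteq> orthogonal_maps" "rotations \<subseteq> A" and r: "r > 0"
    and derivable: "\<And>\<Phi> z. \<Phi> \<in> motions A \<Longrightarrow> agree (move \<Phi> T1) T1 z r \<Longrightarrow> agree (move \<Phi> T2) T2 z 1"
begin

abbreviation "derived \<equiv> derived_tiling r T1 T2"

lemma A_motion: "\<Phi> \<in> motions A \<Longrightarrow> \<Phi> \<in> motions orthogonal_maps"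
  by (rule motions_mono[OF A(1)])

lemma derivable_translates:
  assumes \<Phi>: "\<Phi> \<in> motions A"
    and "agree (move \<Phi> (move ((+) u) T1)) (move ((+) w) T1) z r"
  shows "agree (move \<Phi> (move ((+) u) T2)) (move ((+) w) T2) z 1"
proof -
  have *: "agree (move \<Phi> (move ((+) u) T)) (move ((+) w) T) z R \<longleftrightarrow>
      agree (move ((+) (- w) \<circ> \<Phi> \<circ> (+) u) T) T (z - w) R" for T :: "('n, 'm) tiling" and R
    using agree_move[of "(+) (- w)" "move \<Phi> (move ((+) u) T)" "move ((+) w) T" z R]
    by (simp add: move_comp comp_assoc) (simp add: comp_def)
  show ?thesis
    using assms(2) unfolding * by (rule derivable[OF motions_translate[OF A(1) \<Phi>]])
qed

lemma derivable_translation: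
  assumes "agree (move ((+) u) T1) (move ((+) w) T1) z r"
  shows "agree (move ((+) u) T2) (move ((+) w) T2) z 1"
proof -
  have "id \<in> motions A" using linear_in_motions A(2) rotations_closed(1) by blast
  from derivable_translates[OF this, of u w z] assms show ?thesis by simp
qed

text \<open>Where \<open>S\<close> coincides with \<open>T1 + u\<close>, its derived tiling coincides with \<open>T2 + u\<close>, up to the loss of \<open>r\<close> in
  the radius. A tile of the derived tiling may come from a distant point \<open>z\<close>; it is compared with
  \<open>T2 + u\<close> through a translate that agrees with \<open>S\<close> on a ball containing both places.\<close>

proposition derived_agree:
  assumes S: "S \<in> tiling_hull T1" and u: "agree S (move ((+) u) T1) y R"
  shows "agree (derived S) (move ((+) u) T2) y (R - r)"
  unfolding agree_iff
proof (intro allI impI iffI)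
  fix t :: "('n, 'k) tile" assume "fst t \<inter> cball y (R - r) \<noteq> {}"
  then obtain p where p: "p \<in> fst t" "dist p y \<le> R - r" by (auto simp: dist_commute)
  have t_p: "t \<in> r_patch T p 1 \<longleftrightarrow> t \<in> T" for T
    using p(1) by (auto simp: r_patch_def)
  have up: "agree S (move ((+) u) T1) p r" using u by (rule agree_mono) (use p(2) in simp)
  {
    assume "t \<in> move ((+) u) T2"
    then have "t \<in> r_patch (move ((+) u) T2) p 1" by (simp only: t_p)
    with agree_sym[OF up] show "t \<in> derived S"
      unfolding derived_tiling_def by blast
  next
    assume "t \<in> derived S"
    then obtain w z where w: "agree (move ((+) w) T1) S z r" "t \<in> r_patch (move ((+) w) T2) z 1"
      by (auto simp: derived_tiling_def)
    \<comment> \<open>A translate of \<open>T1\<close> that agrees with \<open>S\<close> around both \<open>z\<close> and \<open>p\<close>.\<close>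
    obtain v where v: "agree S (move ((+) v) T1) p (dist z p + r)"
      using hull_local[OF T1 S] .
    have vz: "agree S (move ((+) v) T1) z r" and vp: "agree S (move ((+) v) T1) p r"
      using v by (auto elim: agree_mono)
    have "agree (move ((+) w) T2) (move ((+) v) T2) z 1"
      by (rule derivable_translation) (rule agree_trans[OF w(1) vz])
    with w(2) have "t \<in> move ((+) v) T2" by (auto simp: agree_def r_patch_def)
    moreover have "agree (move ((+) v) T2) (move ((+) u) T2) p 1"
      by (rule derivable_translation) (rule agree_trans[OF agree_sym[OF vp] up])
    ultimately show "t \<in> move ((+) u) T2"
      using t_p[of "move ((+) v) T2"] t_p[of "move ((+) u) T2"] by (simp add: agree_def)
  }
qed

lemma derived_in_hull:
  assumes S: "S \<in> tiling_hull T1"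
  shows "derived S \<in> tiling_hull T2"
  unfolding tiling_hull_iff[OF T2]
proof (intro conjI allI)
  show "proper (derived S)"
    by (auto simp: proper_def derived_tiling_def r_patch_def)
  fix R
  obtain v where "agree S (move ((+) v) T1) 0 (R + r)" using hull_local[OF T1 S] .
  from derived_agree[OF S this] show "\<exists>v. agree (derived S) (move ((+) v) T2) 0 R" by auto
qed

text \<open>A motion that identifies balls of hull elements identifies slightly smaller balls of the derived
  tilings: locally both hull elements are translates of \<open>T1\<close>, which reduces the claim to \<open>T1\<close> itself.\<close>

proposition derived_equivariant:
  assumes S: "S \<in> tiling_hull T1" and S': "S' \<in> tiling_hull T1" and \<Phi>: "\<Phi> \<in> motions A"
    and agr: "agree (move \<Phi> S) S' y R"
  shows "agree (move \<Phi> (derived S)) (derived S') y (R - r)"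
proof -
  obtain x where y: "y = \<Phi> x" using motion_bij[OF A_motion[OF \<Phi>]] by (metis bij_pointE)
  note mv = agree_move[OF A_motion[OF \<Phi>]]
  obtain u where u: "agree S (move ((+) u) T1) x R" using hull_local[OF T1 S] .
  obtain u' where u': "agree S' (move ((+) u') T1) y R" using hull_local[OF T1 S'] .
  have "agree (move \<Phi> (move ((+) u) T1)) (move \<Phi> S) y R"
    using u unfolding y mv by (rule agree_sym)
  then have T1_agree: "agree (move \<Phi> (move ((+) u) T1)) (move ((+) u') T1) y R"
    using agr u' by (blast intro: agree_trans)
  have "agree (move \<Phi> (move ((+) u) T2)) (move ((+) u') T2) y (R - r)"
  proof (rule agree_cover)
    fix p assume "p \<in> cball y (R - r)"
    then have "agree (move \<Phi> (move ((+) u) T1)) (move ((+) u') T1) p r"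
      by (intro agree_mono[OF T1_agree]) (simp add: dist_commute)
    then show "agree (move \<Phi> (move ((+) u) T2)) (move ((+) u') T2) p 1"
      by (rule derivable_translates[OF \<Phi>])
  qed
  moreover have "agree (move \<Phi> (derived S)) (move \<Phi> (move ((+) u) T2)) y (R - r)"
    unfolding y mv by (rule derived_agree[OF S u])
  ultimately show ?thesis
    using agree_sym[OF derived_agree[OF S' u']] by (blast intro: agree_trans)
qed

lemma derived_proper: "S \<in> tiling_hull T1 \<Longrightarrow> proper (derived S)"
  using derived_in_hull tiling_hull_iff[OF T2] by blast

lemma proper_move: "proper T \<Longrightarrow> proper (move \<Phi> T)"
  by (auto simp: proper_def move_eq)

lemma derived_move:
  assumes "S \<in> tiling_hull T1" "move \<Phi> S \<in> tiling_hull T1" "\<Phi> \<in> motions A"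
  shows "derived (move \<Phi> S) = move \<Phi> (derived S)"
proof (rule agree_everywhere)
  fix R show "agree (derived (move \<Phi> S)) (move \<Phi> (derived S)) 0 R"
    using derived_equivariant[OF assms agree_refl, of 0 "R + r"] by (simp add: agree_sym)
qed (use assms derived_proper proper_move in auto)

lemma derived_self: "derived T1 = T2"
proof (rule agree_everywhere)
  fix R show "agree (derived T1) T2 0 R"
    using derived_agree[OF tiling_in_hull[OF T1], of 0 0 "R + r"] by simp
qed (use derived_proper tiling_in_hull T1 T2 tiling_proper in auto)

lemma acts_on_transfer:
  assumes "g \<in> A" "acts_on g T1"
  shows "acts_on g T2"
proof -
  have g: "g \<in> orthogonal_maps" using assms(1) A(1) by blast
  then have gT: "move g T1 \<in> tiling_hull T1" using assms(2) by (simp add: acts_on_iff_hull T1)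
  have "move g T2 = derived (move g T1)"
    using derived_move[OF tiling_in_hull[OF T1] gT linear_in_motions[OF assms(1)]]
    by (simp add: derived_self)
  then show ?thesis
    using derived_in_hull[OF gT] by (simp add: acts_on_iff_hull T2 g)
qed

text \<open>Continuity, quantitatively. The constant is chosen such that a ball of radius \<open>1 / \<epsilon> + r\<close> for \<open>S\<close> leaves
  a ball of radius \<open>1 / \<epsilon>\<close> for the derived tiling.\<close>

lemma derived_close:
  assumes S: "S \<in> tiling_hull T1" "S' \<in> tiling_hull T1" and "\<epsilon> > 0"
    and close: "close_tilings (1 / (1 / \<epsilon> + r)) S S'"
  shows "close_tilings \<epsilon> (derived S) (derived S')"
proof -
  let ?\<delta> = "1 / (1 / \<epsilon> + r)"
  have "1 / \<epsilon> > 0" using \<open>\<epsilon> > 0\<close> by simp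
  then have "?\<delta> \<le> 1 / (1 / \<epsilon>)" using r by (intro frac_le) simp_all
  then have \<delta>: "1 / ?\<delta> - r = 1 / \<epsilon>" "?\<delta> \<le> \<epsilon>" by simp_all
  obtain v w \<rho> \<sigma> where h: "\<rho> \<in> rotations" "\<sigma> \<in> rotations" "norm v < ?\<delta>" "norm w < ?\<delta>"
    "onorm (\<lambda>x. \<rho> x - x) < ?\<delta>" "onorm (\<lambda>x. \<sigma> x - x) < ?\<delta>"
    "agree (move \<rho> (move ((+) v) S)) (move \<sigma> (move ((+) w) S')) 0 (1 / ?\<delta>)"
    using close unfolding close_tilings_def agree_def by blast
  have comp: "\<Theta> \<circ> \<Theta>' \<in> motions rotations" if "\<Theta> \<in> motions rotations" "\<Theta>' \<in> motions rotations"
    for \<Theta> \<Theta>' :: "'n motion"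
    by (rule motion_comp[OF rotations_subset _ that]) (rule rotations_closed(2))
  note tr = translation_in_motions[OF rotations_closed(1)]
  \<comment> \<open>The motions \<open>\<Phi>\<close> and \<open>\<Psi>\<close> of the two tilings are replaced by the single motion \<open>\<Psi>\<^sup>-\<^sup>1 \<circ> \<Phi>\<close> of \<open>S\<close>.\<close>
  define \<Phi> \<Psi> where "\<Phi> = \<rho> \<circ> (+) v" and "\<Psi> = \<sigma> \<circ> (+) w"
  have \<Phi>: "\<Phi> \<in> motions rotations" and \<Psi>: "\<Psi> \<in> motions rotations"
    unfolding \<Phi>_def \<Psi>_def
    by (rule comp[OF linear_in_motions[OF h(1)] tr], rule comp[OF linear_in_motions[OF h(2)] tr])
  obtain \<Psi>' where \<Psi>': "\<Psi>' \<in> motions rotations" "\<Psi>' \<circ> \<Psi> = id" "\<Psi> \<circ> \<Psi>' = id"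
    using motion_inverse[OF rotations_subset rotations_closed(3) \<Psi>] .
  have \<Psi>m: "\<Psi> \<in> motions orthogonal_maps" by (rule motions_mono[OF rotations_subset \<Psi>])
  have \<Xi>: "\<Psi>' \<circ> \<Phi> \<in> motions A" by (rule motions_mono[OF A(2) comp[OF \<Psi>'(1) \<Phi>]])
  have eq: "\<Psi> \<circ> (\<Psi>' \<circ> \<Phi>) = \<Phi>" "\<Psi> (\<Psi>' 0) = 0"
    using \<Psi>'(3) by (auto simp: fun_eq_iff)
  have iff: "agree (move \<Phi> U) (move \<Psi> U') 0 R \<longleftrightarrow> agree (move (\<Psi>' \<circ> \<Phi>) U) U' (\<Psi>' 0) R"
    for U U' :: "('n, 'm) tiling" and R
    using agree_move[OF \<Psi>m, of "move (\<Psi>' \<circ> \<Phi>) U" U' "\<Psi>' 0" R] by (simp only: move_comp eq)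
  have "agree (move (\<Psi>' \<circ> \<Phi>) S) S' (\<Psi>' 0) (1 / ?\<delta>)"
    unfolding iff[symmetric] using h(7) by (simp only: \<Phi>_def \<Psi>_def move_comp)
  from derived_equivariant[OF S \<Xi> this]
  have "agree (move \<Phi> (derived S)) (move \<Psi> (derived S')) 0 (1 / \<epsilon>)"
    by (simp only: iff \<delta>(1))
  then have "r_patch (move \<rho> (move ((+) v) (derived S))) 0 (1 / \<epsilon>) =
      r_patch (move \<sigma> (move ((+) w) (derived S'))) 0 (1 / \<epsilon>)"
    by (simp only: agree_def move_comp \<Phi>_def \<Psi>_def)
  moreover have "norm v < \<epsilon>" "norm w < \<epsilon>" "onorm (\<lambda>x. \<rho> x - x) < \<epsilon>" "onorm (\<lambda>x. \<sigma> x - x) < \<epsilon>"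
    using h(3-6) \<delta>(2) by linarith+
  ultimately show ?thesis using h(1,2) unfolding close_tilings_def by blast
qed

lemma derived_continuous: "continuous_map (hull_topology T1) (hull_topology T2) derived"
  unfolding continuous_map_def topspace_hull_topology
proof (intro conjI allI impI)
  show "derived \<in> tiling_hull T1 \<rightarrow> tiling_hull T2" using derived_in_hull by blast
  fix U assume U: "openin (hull_topology T2) U"
  have "\<exists>\<delta>>0. \<forall>S'\<in>tiling_hull T1. close_tilings \<delta> S S' \<longrightarrow> S' \<in> {S \<in> tiling_hull T1. derived S \<in> U}"
    if S: "S \<in> tiling_hull T1" "derived S \<in> U" for S
  proof -
    obtain \<epsilon> where \<epsilon>: "\<epsilon> > 0" "\<forall>S'\<in>tiling_hull T2. close_tilings \<epsilon> (derived S) S' \<longrightarrow> S' \<in> U"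
      using U S(2) unfolding openin_hull_topology by blast
    have "1 / (1 / \<epsilon> + r) > 0" using \<epsilon>(1) r by (simp add: add_pos_pos)
    then show ?thesis
      using derived_close[OF S(1) _ \<epsilon>(1)] \<epsilon>(2) derived_in_hull by blast
  qed
  then show "openin (hull_topology T1) {S \<in> tiling_hull T1. derived S \<in> U}"
    unfolding openin_hull_topology by blast
qed

end

lemma derived_inverse:
  assumes D: "local_derivation T1 T2 A r" and D': "local_derivation T2 T1 A r'"
    and S: "S \<in> tiling_hull T1"
  shows "derived_tiling r' T2 T1 (derived_tiling r T1 T2 S) = S"
proof (rule agree_everywhere)
  note T1 = local_derivation.T1[OF D]
  note DS = local_derivation.derived_in_hull[OF D S]
  show "proper (derived_tiling r' T2 T1 (derived_tiling r T1 T2 S))"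
    by (rule local_derivation.derived_proper[OF D' DS])
  show "proper S" by (rule tiling_proper[OF hull_is_tiling[OF S]])
  fix R
  obtain u where u: "agree S (move ((+) u) T1) 0 (R + r' + r)" using hull_local[OF T1 S] .
  from local_derivation.derived_agree[OF D S u]
  have "agree (derived_tiling r T1 T2 S) (move ((+) u) T2) 0 (R + r')" by simp
  from local_derivation.derived_agree[OF D' DS this]
  have "agree (derived_tiling r' T2 T1 (derived_tiling r T1 T2 S)) (move ((+) u) T1) 0 R" by simp
  moreover have "agree S (move ((+) u) T1) 0 R"
    using u by (rule agree_mono) (use local_derivation.r[OF D] local_derivation.r[OF D'] in simp)
  ultimately show "agree (derived_tiling r' T2 T1 (derived_tiling r T1 T2 S)) S 0 R"
    by (blast intro: agree_trans agree_sym)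
qed

lemma locally_derivable_imp_local_derivation:
  assumes "is_tiling T1" "is_tiling T2" "A \<subseteq> orthogonal_maps" "rotations \<subseteq> A" "locally_derivable A T1 T2"
  obtains r where "local_derivation T1 T2 A r"
proof -
  obtain r where r: "r > 0" "\<And>g v x. g \<in> A \<Longrightarrow>
      move (\<lambda>y. g y + v) (r_patch T1 x r) = r_patch T1 (g x + v) r \<Longrightarrow>
      move (\<lambda>y. g y + v) (r_patch T2 x 1) = r_patch T2 (g x + v) 1"
    using assms(5) unfolding locally_derivable_def Let_def by blast
  have "local_derivation T1 T2 A r"
  proof
    fix \<Phi> z assume \<Phi>: "\<Phi> \<in> motions A" and agr: "agree (move \<Phi> T1) T1 z r"
    have m: "\<Phi> \<in> motions orthogonal_maps" by (rule motions_mono[OF assms(3) \<Phi>])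
    obtain x where z: "z = \<Phi> x" using motion_bij[OF m] by (metis bij_pointE)
    obtain g v where g: "g \<in> A" "\<Phi> = (\<lambda>y. g y + v)" using \<Phi> by (auto simp: motions_def)
    have "move \<Phi> (r_patch T1 x r) = r_patch T1 (\<Phi> x) r"
      using agr by (simp add: agree_def z r_patch_move[OF m])
    then have "move \<Phi> (r_patch T2 x 1) = r_patch T2 (\<Phi> x) 1"
      using r(2)[OF g(1)] unfolding g(2) by blast
    then show "agree (move \<Phi> T2) T2 z 1" by (simp add: agree_def z r_patch_move[OF m])
  qed (use assms r(1) in auto)
  then show thesis by (rule that)
qed

section \<open>Point groups\<close>

text \<open>A point group is determined by the tiling: it consists of all rotations that act, because a
  rotation that acts sends the patches that detect the group back into \<open>T\<close>.\<close>

lemma point_group_eq: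
  assumes T: "is_tiling T" and G: "has_point_group T G"
  shows "G = {g \<in> rotations. acts_on g T}"
proof -
  obtain r where r: "\<forall>x. \<forall>g\<in>rotations. appears_in (move g (r_patch T x r)) T \<longrightarrow> g \<in> G"
    using G unfolding has_point_group_def by blast
  have "appears_in (move g (r_patch T 0 r)) T" if "acts_on g T" for g
    using that finite_r_patch[OF T] by (auto simp: acts_on_def r_patch_def)
  then have "{g \<in> rotations. acts_on g T} \<subseteq> G" using r by blast
  moreover have "G \<subseteq> {g \<in> rotations. acts_on g T}"
    using G unfolding has_point_group_def by blast
  ultimately show ?thesis by blast
qed

lemma G_pm_eq:
  assumes "is_tiling T" "has_point_group T G"
  shows "G_pm T G = {g \<in> orthogonal_maps. acts_on g T}"
  using point_group_eq[OF assms] rotations_subset unfolding G_pm_def by blast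

lemma acts_on_comp:
  assumes "is_tiling T" "g \<in> orthogonal_maps" "acts_on g T" "h \<in> orthogonal_maps" "acts_on h T"
  shows "acts_on (g \<circ> h) T"
proof -
  have "move g (move h T) \<in> tiling_hull T"
    by (intro hull_move assms tiling_in_hull)
  then show ?thesis
    by (simp add: acts_on_iff_hull assms orthogonal_maps_closed move_comp)
qed

lemma group_orthogonal_group: "group (orthogonal_group :: 'n::finite motion monoid)" (is "group ?O")
proof (rule groupI)
  fix g :: "'n motion" assume "g \<in> carrier ?O"
  then have g: "g \<in> orthogonal_maps" by (simp add: orthogonal_group_def)
  then have "inv_into UNIV g \<circ> g = id"
    by (simp add: orthogonal_maps_iff orthogonal_transformation_inj)
  then show "\<exists>h\<in>carrier ?O. h \<otimes>\<^bsub>?O\<^esub> g = \<one>\<^bsub>?O\<^esub>"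
    using orthogonal_maps_closed(2)[OF g] by (auto simp: orthogonal_group_def)
qed (auto simp: orthogonal_group_def orthogonal_maps_closed)

lemma orthogonal_subgroupD:
  assumes "subgroup H orthogonal_group" "h \<in> H"
  shows "h \<in> orthogonal_maps" "\<exists>h'\<in>H. h \<circ> h' = id"
proof -
  let ?O = "orthogonal_group :: 'a motion monoid"
  show h: "h \<in> orthogonal_maps"
    using subgroup.mem_carrier[OF assms] by (simp add: orthogonal_group_def)
  have "h \<otimes>\<^bsub>?O\<^esub> inv\<^bsub>?O\<^esub> h = \<one>\<^bsub>?O\<^esub>"
    by (rule group.r_inv[OF group_orthogonal_group]) (simp add: orthogonal_group_def h)
  then have "h \<circ> inv\<^bsub>?O\<^esub> h = id"
    by (simp add: orthogonal_group_def)
  then show "\<exists>h'\<in>H. h \<circ> h' = id"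
    using subgroup.m_inv_closed[OF assms] by blast
qed

text \<open>The product of two reflections that act is a rotation that acts, so the reflections form a single
  coset of the finite group \<open>G\<close> or do not occur.\<close>

lemma finite_subgroup_G_pm:
  assumes T: "is_tiling T" and G: "has_point_group T G"
  shows "finite (G_pm T G)" "subgroup (G_pm T G) orthogonal_group"
proof -
  let ?O = "orthogonal_group :: 'a motion monoid"
  note eq = G_pm_eq[OF T G] and eqG = point_group_eq[OF T G]
  have finG: "finite G" and subG: "subgroup G ?O"
    using G by (simp_all add: has_point_group_def)
  have comp: "g \<circ> h \<in> G_pm T G" if "g \<in> G_pm T G" "h \<in> G_pm T G" for g h
    using that unfolding eq by (simp add: acts_on_comp[OF T] orthogonal_maps_closed)
  have id: "id \<in> G_pm T G"
    using subgroup.one_closed[OF subG] by (simp add: G_pm_def orthogonal_group_def)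
  interpret group ?O by (rule group_orthogonal_group)
  have m_eq: "g \<otimes>\<^bsub>?O\<^esub> h = g \<circ> h" for g h by (simp add: orthogonal_group_def)
  have carrier: "g \<in> carrier ?O" if "g \<in> G_pm T G" for g
    using that by (simp add: eq orthogonal_group_def)
  have GG: "G \<subseteq> G_pm T G" by (simp add: G_pm_def)
  have refl: "g \<circ> h \<in> G" if "g \<in> G_pm T G - G" "h \<in> G_pm T G - G" for g h
  proof -
    have "g \<circ> h \<in> rotations"
      by (rule reflections_comp) (use that in \<open>auto simp: G_pm_def\<close>)
    moreover have "acts_on (g \<circ> h) T"
      using comp[of g h] that by (simp add: eq)
    ultimately show ?thesis by (subst eqG) simp
  qed
  have inv: "inv\<^bsub>?O\<^esub> g \<in> G_pm T G" if g: "g \<in> G_pm T G" for g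
  proof (cases "g \<in> G")
    case True
    then show ?thesis using subgroup.m_inv_closed[OF subG] GG by blast
  next
    case False
    \<comment> \<open>The square of a reflection in the group lies in \<open>G\<close>, where inverses are at hand.\<close>
    then have "inv\<^bsub>?O\<^esub> (g \<otimes>\<^bsub>?O\<^esub> g) \<in> G"
      using refl[of g g] g subgroup.m_inv_closed[OF subG] by (simp add: m_eq)
    then have "g \<otimes>\<^bsub>?O\<^esub> inv\<^bsub>?O\<^esub> (g \<otimes>\<^bsub>?O\<^esub> g) \<in> G_pm T G"
      using comp[OF g] GG by (auto simp: m_eq)
    moreover have "g \<otimes>\<^bsub>?O\<^esub> inv\<^bsub>?O\<^esub> (g \<otimes>\<^bsub>?O\<^esub> g) = inv\<^bsub>?O\<^esub> g"
      using carrier[OF g] by (simp add: inv_mult_group m_assoc[symmetric])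
    ultimately show ?thesis by simp
  qed
  show sub: "subgroup (G_pm T G) ?O"
    by (rule subgroupI) (use carrier id inv comp in \<open>auto simp: m_eq\<close>)
  show "finite (G_pm T G)"
  proof (cases "G_pm T G \<subseteq> G")
    case False
    then obtain h where h: "h \<in> G_pm T G - G" by blast
    have h': "inv\<^bsub>?O\<^esub> h \<in> G_pm T G - G"
      using inv[of h] h subgroup.m_inv_closed[OF subG, of "inv\<^bsub>?O\<^esub> h"] carrier[of h] by auto
    have "G_pm T G \<subseteq> G \<union> (\<lambda>k. h \<otimes>\<^bsub>?O\<^esub> k) ` G"
    proof
      fix g assume g: "g \<in> G_pm T G"
      show "g \<in> G \<union> (\<lambda>k. h \<otimes>\<^bsub>?O\<^esub> k) ` G"
      proof (cases "g \<in> G")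
        case False
        then have "inv\<^bsub>?O\<^esub> h \<otimes>\<^bsub>?O\<^esub> g \<in> G" using refl[OF h'] g by (simp add: m_eq)
        moreover have "g = h \<otimes>\<^bsub>?O\<^esub> (inv\<^bsub>?O\<^esub> h \<otimes>\<^bsub>?O\<^esub> g)"
          using carrier[OF g] carrier[of h] h by (simp add: m_assoc[symmetric])
        ultimately show ?thesis by blast
      qed simp
    qed
    then show ?thesis by (rule finite_subset) (use finG in auto)
  qed (use finG finite_subset in blast)
qed

section \<open>Maps of Borel constructions\<close>

text \<open>Points of Borel constructions are orbits, that is, sets of pairs. An equivariant map acts on them
  through the first components.\<close>

definition orbit_map :: "('y \<Rightarrow> 'z) \<Rightarrow> ('y \<times> 'e) set \<Rightarrow> ('z \<times> 'e) set" where
  "orbit_map F Q = (\<lambda>(c, y). (F c, y)) ` Q"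

lemma orbit_map_diagonal_orbit:
  assumes "\<And>h. h \<in> H \<Longrightarrow> F (a h c) = a' h (F c)"
  shows "orbit_map F (diagonal_orbit H a E (c, y)) = diagonal_orbit H a' E (F c, y)"
  using assms by (auto simp: orbit_map_def diagonal_orbit_def image_image intro!: image_cong)

lemma topspace_identification_topology:
  "topspace (identification_topology X q) = q ` topspace X"
  using quotient_imp_surjective_map[OF quotient_map_identification_topology] by metis

lemma continuous_map_identification_topology:
  "continuous_map X Z (f \<circ> q) \<Longrightarrow> continuous_map (identification_topology X q) Z f"
  by (rule continuous_compose_quotient_map[OF quotient_map_identification_topology])

lemma continuous_map_identification: "continuous_map X (identification_topology X q) q"
  by (rule quotient_imp_continuous_map[OF quotient_map_identification_topology])

lemma topspace_borel_construction:
  "topspace (borel_construction H Y a E) =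
    diagonal_orbit H a E ` (topspace Y \<times> topspace (space_of E))"
  by (simp add: borel_construction_def topspace_identification_topology)

text \<open>The product of \<open>F\<close> with the identity is continuous, and so is the map that it induces on the
  quotients by the diagonal actions.\<close>

lemma continuous_orbit_map:
  assumes F: "continuous_map Y Y' F"
    and equiv: "\<And>h c. h \<in> H \<Longrightarrow> c \<in> topspace Y \<Longrightarrow> F (a h c) = a' h (F c)"
  shows "continuous_map (borel_construction H Y a E) (borel_construction H Y' a' E) (orbit_map F)"
  unfolding borel_construction_def
proof (rule continuous_map_identification_topology)
  let ?X = "prod_topology Y (space_of E)" and ?X' = "prod_topology Y' (space_of E)"
  let ?q' = "diagonal_orbit H a' E"
  have "continuous_map ?X ?X' (\<lambda>z. (F (fst z), snd z))"
    using continuous_map_pairedI[OF continuous_map_compose[OF continuous_map_fst F] continuous_map_snd]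
    by (simp only: comp_def)
  from continuous_map_compose[OF this continuous_map_identification]
  have "continuous_map ?X (identification_topology ?X' ?q') (?q' \<circ> (\<lambda>z. (F (fst z), snd z)))" .
  then show "continuous_map ?X (identification_topology ?X' ?q') (orbit_map F \<circ> diagonal_orbit H a E)"
  proof (rule continuous_map_eq)
    fix z assume "z \<in> topspace ?X"
    then have "fst z \<in> topspace Y" by auto
    then show "(?q' \<circ> (\<lambda>z. (F (fst z), snd z))) z = (orbit_map F \<circ> diagonal_orbit H a E) z"
      using orbit_map_diagonal_orbit[of H F a "fst z" a' E "snd z"] equiv by simp
  qed
qed

section \<open>Maps of hulls and of their approximants\<close>

lemma agreement_class_eq: "agreement_class T n S = {S' \<in> tiling_hull T. agree S' S 0 (real n)}"
  by (simp add: agreement_class_def agree_def)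

lemma agreement_class_cong: "agree S S' 0 (real n) \<Longrightarrow> agreement_class T n S = agreement_class T n S'"
  by (auto simp: agreement_class_eq intro: agree_trans agree_sym)

lemma self_in_agreement_class: "S \<in> tiling_hull T \<Longrightarrow> S \<in> agreement_class T n S"
  by (simp add: agreement_class_eq)

lemma topspace_approximant: "topspace (approximant T n) = agreement_class T n ` tiling_hull T"
  by (simp add: approximant_def topspace_identification_topology topspace_hull_topology)

text \<open>The groups \<open>H\<close> for which the Borel construction over the hull of \<open>T\<close> is formed.\<close>

definition acts_by_symmetries :: "'n::finite motion set \<Rightarrow> ('n, 'l) tiling \<Rightarrow> bool" where
  "acts_by_symmetries H T \<longleftrightarrow> subgroup H orthogonal_group \<and> (\<forall>h\<in>H. acts_on h T)"

lemma symmetry_move_hull: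
  assumes "is_tiling T" "acts_by_symmetries H T" "h \<in> H" "S \<in> tiling_hull T"
  shows "move h S \<in> tiling_hull T"
  using assms by (auto simp: acts_by_symmetries_def intro: hull_move orthogonal_subgroupD(1))

lemma symmetry_agree:
  assumes "acts_by_symmetries H T" "h \<in> H"
  shows "agree (move h S) (move h S') 0 R \<longleftrightarrow> agree S S' 0 R"
proof -
  have h: "h \<in> orthogonal_maps"
    using assms by (auto simp: acts_by_symmetries_def intro: orthogonal_subgroupD(1))
  then have "h 0 = 0"
    by (simp add: orthogonal_maps_iff orthogonal_transformation_linear linear_0)
  then show ?thesis
    using agree_move[OF linear_in_motions[OF h], of S S' 0 R] by simp
qed

text \<open>The symmetries fix the origin and preserve the balls about it, so that they permute the agreement
  classes. Inverses in \<open>H\<close> are needed for the image to be a whole class.\<close>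

lemma move_agreement_class:
  assumes T: "is_tiling T" and H: "acts_by_symmetries H T" and h: "h \<in> H"
  shows "move h ` agreement_class T n S = agreement_class T n (move h S)"
proof (intro equalityI subsetI)
  fix U assume "U \<in> agreement_class T n (move h S)"
  then have U: "U \<in> tiling_hull T" "agree U (move h S) 0 (real n)"
    by (simp_all add: agreement_class_eq)
  obtain h' where h': "h' \<in> H" "h \<circ> h' = id"
    using orthogonal_subgroupD(2)[OF _ h] H by (auto simp: acts_by_symmetries_def)
  then have eq: "U = move h (move h' U)" by (simp add: move_comp)
  have "move h' U \<in> agreement_class T n S"
    using U(2) symmetry_move_hull[OF T H h'(1) U(1)] symmetry_agree[OF H h, of "move h' U" S]
    by (simp add: agreement_class_eq eq[symmetric])
  then show "U \<in> move h ` agreement_class T n S" using eq by blast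
qed (use symmetry_move_hull[OF T H h] symmetry_agree[OF H h] in \<open>auto simp: agreement_class_eq\<close>)

text \<open>A map \<open>D\<close> of hulls induces \<open>approximant_map T n D\<close> on agreement classes. For \<open>D = id\<close> this is a
  bonding map.\<close>

definition approximant_map ::
  "('n::finite, 'k) tiling \<Rightarrow> nat \<Rightarrow> (('n, 'l) tiling \<Rightarrow> ('n, 'k) tiling) \<Rightarrow>
    ('n, 'l) tiling set \<Rightarrow> ('n, 'k) tiling set" where
  "approximant_map T n D C = \<Union>(agreement_class T n ` D ` C)"

text \<open>\<open>hull_map H T1 T2 m n D\<close>: the map \<open>D\<close> of hulls is continuous, equivariant and pointed, and the
  ball of radius \<open>m\<close> of \<open>S\<close> determines the ball of radius \<open>n\<close> of \<open>D S\<close>.\<close>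

definition hull_map ::
  "'n::finite motion set \<Rightarrow> ('n, 'l) tiling \<Rightarrow> ('n, 'k) tiling \<Rightarrow> nat \<Rightarrow> nat \<Rightarrow>
    (('n, 'l) tiling \<Rightarrow> ('n, 'k) tiling) \<Rightarrow> bool" where
  "hull_map H T1 T2 m n D \<longleftrightarrow>
     continuous_map (hull_topology T1) (hull_topology T2) D \<and> D T1 = T2 \<and>
     (\<forall>S\<in>tiling_hull T1. \<forall>h\<in>H. D (move h S) = move h (D S)) \<and>
     (\<forall>S\<in>tiling_hull T1. \<forall>S'\<in>tiling_hull T1. agree S S' 0 (real m) \<longrightarrow> agree (D S) (D S') 0 (real n))"

lemma hull_map_id: "n \<le> m \<Longrightarrow> hull_map H T T m n id"
  by (auto simp: hull_map_def elim: agree_mono)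

text \<open>The space \<open>(K\<^sub>n \<times> EH)/H\<close> and its point that is represented by \<open>(S, y)\<close>.\<close>

abbreviation approximant_borel where
  "approximant_borel H E T n \<equiv> borel_construction H (approximant T n) (\<lambda>g C. move g ` C) E"

abbreviation approximant_orbit where
  "approximant_orbit H E T n S y \<equiv> diagonal_orbit H (\<lambda>g C. move g ` C) E (agreement_class T n S, y)"

context
  fixes H :: "'n::finite motion set" and T1 :: "('n, 'l) tiling" and T2 :: "('n, 'k) tiling"
  assumes T: "is_tiling T1" "is_tiling T2"
    and H: "acts_by_symmetries H T1" "acts_by_symmetries H T2"
begin

lemma approximant_map_agreement_class:
  assumes D: "hull_map H T1 T2 m n D" and S: "S \<in> tiling_hull T1"
  shows "approximant_map T2 n D (agreement_class T1 m S) = agreement_class T2 n (D S)"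
proof -
  have "agreement_class T2 n (D S') = agreement_class T2 n (D S)" if "S' \<in> agreement_class T1 m S" for S'
    using D S that by (intro agreement_class_cong) (auto simp: hull_map_def agreement_class_eq)
  then show ?thesis
    unfolding approximant_map_def image_image
    by (intro UN_constant_eq[OF self_in_agreement_class[OF S]] ballI)
qed

lemma approximant_map_equivariant:
  assumes D: "hull_map H T1 T2 m n D" and h: "h \<in> H" and C: "C \<in> topspace (approximant T1 m)"
  shows "approximant_map T2 n D (move h ` C) = move h ` approximant_map T2 n D C"
proof -
  obtain S where S: "S \<in> tiling_hull T1" "C = agreement_class T1 m S"
    using C by (auto simp: topspace_approximant)
  have "D (move h S) = move h (D S)" using D S(1) h by (simp add: hull_map_def)
  then show ?thesis
    using S symmetry_move_hull[OF T(1) H(1) h S(1)]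
    by (simp add: move_agreement_class[OF T(1) H(1) h] move_agreement_class[OF T(2) H(2) h]
        approximant_map_agreement_class[OF D])
qed

lemma orbit_map_approximant_orbit:
  assumes D: "hull_map H T1 T2 m n D" and S: "S \<in> tiling_hull T1"
  shows "orbit_map (approximant_map T2 n D) (approximant_orbit H E T1 m S y) =
    approximant_orbit H E T2 n (D S) y"
proof -
  have C: "agreement_class T1 m S \<in> topspace (approximant T1 m)"
    using S by (simp add: topspace_approximant)
  show ?thesis
    using orbit_map_diagonal_orbit[of H "approximant_map T2 n D" "\<lambda>g C. move g ` C"
        "agreement_class T1 m S" "\<lambda>g C. move g ` C" E y]
      approximant_map_equivariant[OF D _ C]
    by (simp add: approximant_map_agreement_class[OF D S])
qed

lemma pointed_map_approximant:
  assumes D: "hull_map H T1 T2 m n D"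
  shows "pointed_map (approximant_borel H E T1 m) (approximant_orbit H E T1 m T1 (base E))
    (approximant_borel H E T2 n) (approximant_orbit H E T2 n T2 (base E))
    (orbit_map (approximant_map T2 n D))"
  unfolding pointed_map_def
proof
  have cont: "continuous_map (hull_topology T1) (hull_topology T2) D" and DT: "D T1 = T2"
    using D by (simp_all add: hull_map_def)
  have "continuous_map (hull_topology T1) (approximant T2 n) (agreement_class T2 n \<circ> D)"
    unfolding approximant_def by (rule continuous_map_compose[OF cont continuous_map_identification])
  then have "continuous_map (hull_topology T1) (approximant T2 n)
      (approximant_map T2 n D \<circ> agreement_class T1 m)"
    by (rule continuous_map_eq) (simp add: topspace_hull_topology approximant_map_agreement_class[OF D])
  then have "continuous_map (approximant T1 m) (approximant T2 n) (approximant_map T2 n D)"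
    unfolding approximant_def[of T1] by (rule continuous_map_identification_topology)
  then show "continuous_map (approximant_borel H E T1 m) (approximant_borel H E T2 n)
      (orbit_map (approximant_map T2 n D))"
    by (rule continuous_orbit_map) (rule approximant_map_equivariant[OF D])
  show "orbit_map (approximant_map T2 n D) (approximant_orbit H E T1 m T1 (base E)) =
      approximant_orbit H E T2 n T2 (base E)"
    using orbit_map_approximant_orbit[OF D tiling_in_hull[OF T(1)]] by (simp add: DT)
qed

lemma pointed_map_Omega:
  assumes D: "hull_map H T1 T2 m n D"
  shows "pointed_map (Omega H E T1) (Omega_base H E T1) (Omega H E T2) (Omega_base H E T2) (orbit_map D)"
  unfolding pointed_map_def Omega_def Omega_base_def
proof
  show "continuous_map (borel_construction H (hull_topology T1) move E)
      (borel_construction H (hull_topology T2) move E) (orbit_map D)"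
    using D by (intro continuous_orbit_map) (auto simp: hull_map_def topspace_hull_topology)
  have "orbit_map D (diagonal_orbit H move E (T1, base E)) = diagonal_orbit H move E (D T1, base E)"
    using D tiling_in_hull[OF T(1)] by (intro orbit_map_diagonal_orbit) (simp add: hull_map_def)
  then show "orbit_map D (diagonal_orbit H move E (T1, base E)) = diagonal_orbit H move E (T2, base E)"
    using D by (simp add: hull_map_def)
qed

end

lemma bonding_map_eq:
  "(\<lambda>n Q. (\<lambda>(C, y). (\<Union>(agreement_class T n ` C), y)) ` Q) = (\<lambda>n. orbit_map (approximant_map T n id))"
  by (simp add: orbit_map_def approximant_map_def fun_eq_iff)

lemma approximant_pro_pi1_eq:
  "approximant_pro_pi1 H E T = pi1_sequence (approximant_borel H E T)
    (\<lambda>n. approximant_orbit H E T n T (base E)) (\<lambda>n. orbit_map (approximant_map T n id))"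
  unfolding approximant_pro_pi1_def bonding_map_eq ..

lemma pointed_system_approximants:
  assumes "is_tiling T" "acts_by_symmetries H T"
  shows "pointed_system (approximant_borel H E T) (\<lambda>n. approximant_orbit H E T n T (base E))
    (\<lambda>n. orbit_map (approximant_map T n id))"
  unfolding pointed_system_def
  by (intro allI pointed_map_approximant[OF assms(1,1) assms(2,2) hull_map_id]) simp

lemma structure_map_approximant_orbit:
  assumes "is_tiling T" "acts_by_symmetries H T" "S \<in> tiling_hull T" "k \<le> i"
  shows "structure_map (\<lambda>n. orbit_map (approximant_map T n id)) i k (approximant_orbit H E T i S y) =
    approximant_orbit H E T k S y"
  using assms(4)
proof (induction i rule: dec_induct)
  case (step i)
  let ?b = "\<lambda>n. orbit_map (approximant_map T n id)"
  have "structure_map ?b (Suc i) k (approximant_orbit H E T (Suc i) S y) =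
      structure_map ?b i k (?b i (approximant_orbit H E T (Suc i) S y))"
    by (subst structure_map_trans[OF step.hyps(1), of "Suc i", symmetric])
      (simp_all add: structure_map_Suc)
  also have "?b i (approximant_orbit H E T (Suc i) S y) = approximant_orbit H E T i S y"
    using orbit_map_approximant_orbit[OF assms(1,1) assms(2,2) hull_map_id assms(3), of i "Suc i" E y]
    by simp
  finally show ?case using step.IH by simp
qed simp

lemma approximant_borel_pointE:
  assumes "z \<in> topspace (approximant_borel H E T n)"
  obtains S y where "S \<in> tiling_hull T" "y \<in> topspace (space_of E)" "z = approximant_orbit H E T n S y"
  using assms by (auto simp: topspace_borel_construction topspace_approximant)

section \<open>Invariance\<close>

lemma (in local_derivation) hull_map_derived:
  assumes H: "H \<subseteq> A" "acts_by_symmetries H T1" and mn: "real n + r \<le> real m"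
  shows "hull_map H T1 T2 m n derived"
  unfolding hull_map_def
proof (intro conjI ballI impI)
  fix S h assume S: "S \<in> tiling_hull T1" and h: "h \<in> H"
  show "derived (move h S) = move h (derived S)"
    using H(1) h by (intro derived_move S symmetry_move_hull[OF T1 H(2) h S] linear_in_motions) blast
next
  fix S S' assume S: "S \<in> tiling_hull T1" "S' \<in> tiling_hull T1" and "agree S S' 0 (real m)"
  then have agr: "agree S S' 0 (real n + r)"
    using mn by (elim agree_mono) simp
  have "id \<in> motions A" using linear_in_motions A(2) rotations_closed(1) by blast
  from derived_equivariant[OF S this, of 0 "real n + r"] agr
  show "agree (derived S) (derived S') 0 (real n)" by simp
qed (rule derived_continuous derived_self)+

context
  fixes T1 :: "('n::finite, 'l1) tiling" and T2 :: "('n, 'l2) tiling"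
    and A H :: "'n motion set" and r1 r2 :: real and E :: "('n, 'e) pointed_action_space"
  assumes D12: "local_derivation T1 T2 A r1" and D21: "local_derivation T2 T1 A r2"
    and HA: "H \<subseteq> A" and H: "acts_by_symmetries H T1" and E: "contractible_free_space H E"
begin

lemma tilings: "is_tiling T1" "is_tiling T2"
  using D12 by (simp_all add: local_derivation.T1 local_derivation.T2)

lemma symmetries_transfer: "acts_by_symmetries H T2"
  using H HA local_derivation.acts_on_transfer[OF D12] by (auto simp: acts_by_symmetries_def)

abbreviation "d12 \<equiv> derived_tiling r1 T1 T2"
abbreviation "d21 \<equiv> derived_tiling r2 T2 T1"

lemmas hull_map_d12 = local_derivation.hull_map_derived[OF D12 HA H]
lemmas hull_map_d21 = local_derivation.hull_map_derived[OF D21 HA symmetries_transfer]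

text \<open>The two maps of hulls induce mutually inverse pointed maps of the Borel constructions.\<close>

lemma Omega_pro_pi1_invariant:
  fixes P1 P2 :: "(real \<Rightarrow> 'u) set pro_group"
  assumes "is_pro_pi1 (Omega H E T1) (Omega_base H E T1) P1"
    and "is_pro_pi1 (Omega H E T2) (Omega_base H E T2) P2"
  shows "pro_equivalent P1 P2" "inverse_limit P1 \<cong> inverse_limit P2"
proof -
  have base: "Omega_base H E T \<in> topspace (Omega H E T)" if "is_tiling T" for T :: "('n, 'l) tiling"
    using E tiling_in_hull[OF that]
    by (auto simp: Omega_def Omega_base_def topspace_borel_construction topspace_hull_topology
        contractible_free_space_def)
  have inv: "orbit_map d' (orbit_map d z) = z"
    if zT: "z \<in> topspace (Omega H E T)" and dd: "\<And>S. S \<in> tiling_hull T \<Longrightarrow> d' (d S) = S"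
      and T: "is_tiling T" "acts_by_symmetries H T" for T d' d z
  proof -
    obtain S y where z: "S \<in> tiling_hull T" "z = diagonal_orbit H move E (S, y)"
      using zT by (auto simp: Omega_def topspace_borel_construction topspace_hull_topology)
    have "orbit_map (d' \<circ> d) z = diagonal_orbit H move E ((d' \<circ> d) S, y)"
      unfolding z(2) using dd symmetry_move_hull[OF T _ z(1)] z(1)
      by (intro orbit_map_diagonal_orbit) simp
    moreover have "orbit_map (d' \<circ> d) z = orbit_map d' (orbit_map d z)"
      by (simp add: orbit_map_def image_image split_beta)
    ultimately show ?thesis using dd[OF z(1)] z(2) by simp
  qed
  obtain m :: nat where m: "r1 \<le> real m" "r2 \<le> real m"
    using real_arch_simple[of "max r1 r2"] by auto
  have p: "pointed_map (Omega H E T1) (Omega_base H E T1) (Omega H E T2) (Omega_base H E T2) (orbit_map d12)"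
    using pointed_map_Omega[OF tilings H symmetries_transfer hull_map_d12[of 0 m]] m by simp
  have p': "pointed_map (Omega H E T2) (Omega_base H E T2) (Omega H E T1) (Omega_base H E T1) (orbit_map d21)"
    using pointed_map_Omega[OF tilings(2,1) symmetries_transfer H hull_map_d21[of 0 m]] m by simp
  have "orbit_map d21 (orbit_map d12 z) = z" if "z \<in> topspace (Omega H E T1)" for z
    by (rule inv[OF that _ tilings(1) H]) (rule derived_inverse[OF D12 D21])
  moreover have "orbit_map d12 (orbit_map d21 z) = z" if "z \<in> topspace (Omega H E T2)" for z
    by (rule inv[OF that _ tilings(2) symmetries_transfer]) (rule derived_inverse[OF D21 D12])
  ultimately have *: "pro_equivalent P1 P2 \<and> inverse_limit P1 \<cong> inverse_limit P2"
    by (intro conjI pro_pi1_invariant[OF assms base[OF tilings(1)] base[OF tilings(2)] p p'])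
  show "pro_equivalent P1 P2" "inverse_limit P1 \<cong> inverse_limit P2" using * by simp_all
qed

text \<open>Both derivations lose at most \<open>c\<close> in the radius. The even multiples of \<open>c\<close> are therefore used as levels
  for \<open>T1\<close> and the odd ones for \<open>T2\<close>; the zigzag of approximants commutes strictly, since the two maps of
  hulls are inverse to each other.\<close>

lemma approximant_pro_pi1_invariant:
  shows "pro_equivalent (approximant_pro_pi1 H E T1) (approximant_pro_pi1 H E T2)"
    "inverse_limit (approximant_pro_pi1 H E T1) \<cong> inverse_limit (approximant_pro_pi1 H E T2)"
proof -
  obtain c :: nat where "max 1 (max r1 r2) \<le> real c" using real_arch_simple by blast
  then have c: "1 \<le> c" "r1 \<le> real c" "r2 \<le> real c" by auto
  define a where "a k = 2 * c * k" for k
  define b where "b k = 2 * c * k + c" for k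
  have ab: "strict_mono a" "strict_mono b"
    using c(1) by (auto simp: strict_mono_Suc_iff a_def b_def)
  have le: "a k \<le> a (Suc k)" "b k \<le> b (Suc k)" for k by (simp_all add: a_def b_def)
  have f: "hull_map H T2 T1 (b k) (a k) d21" for k
    by (rule hull_map_d21) (use c in \<open>simp add: a_def b_def\<close>)
  have g: "hull_map H T1 T2 (a (Suc k)) (b k) d12" for k
    by (rule hull_map_d12) (use c in \<open>simp add: a_def b_def algebra_simps\<close>)
  have base: "approximant_orbit H E T n T (base E) \<in> topspace (approximant_borel H E T n)"
    if "is_tiling T" for n and T :: "('n, 'l) tiling"
    using E tiling_in_hull[OF that]
    by (auto simp: topspace_borel_construction topspace_approximant contractible_free_space_def)
  note fp = pointed_map_approximant[OF tilings(2,1) symmetries_transfer H f]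
  note gp = pointed_map_approximant[OF tilings H symmetries_transfer g]
  note fv = orbit_map_approximant_orbit[OF tilings(2,1) symmetries_transfer H f]
  note gv = orbit_map_approximant_orbit[OF tilings H symmetries_transfer g]
  have fg: "pointed_homotopic (approximant_borel H E T1 (a (Suc k))) (approximant_orbit H E T1 (a (Suc k)) T1 (base E))
      (approximant_borel H E T1 (a k)) (approximant_orbit H E T1 (a k) T1 (base E))
      (orbit_map (approximant_map T1 (a k) d21) \<circ> orbit_map (approximant_map T2 (b k) d12))
      (structure_map (\<lambda>n. orbit_map (approximant_map T1 n id)) (a (Suc k)) (a k))" for k
  proof (rule pointed_homotopic_equal[OF pointed_map_compose[OF gp fp] base[OF tilings(1)]])
    fix z assume "z \<in> topspace (approximant_borel H E T1 (a (Suc k)))"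
    then obtain S y where S: "S \<in> tiling_hull T1" "z = approximant_orbit H E T1 (a (Suc k)) S y"
      by (rule approximant_borel_pointE)
    then show "(orbit_map (approximant_map T1 (a k) d21) \<circ> orbit_map (approximant_map T2 (b k) d12)) z =
        structure_map (\<lambda>n. orbit_map (approximant_map T1 n id)) (a (Suc k)) (a k) z"
      using structure_map_approximant_orbit[OF tilings(1) H S(1) le(1), where E = E]
        local_derivation.derived_in_hull[OF D12 S(1)] derived_inverse[OF D12 D21 S(1)]
      by (simp add: gv fv)
  qed
  have gf: "pointed_homotopic (approximant_borel H E T2 (b (Suc k))) (approximant_orbit H E T2 (b (Suc k)) T2 (base E))
      (approximant_borel H E T2 (b k)) (approximant_orbit H E T2 (b k) T2 (base E))
      (orbit_map (approximant_map T2 (b k) d12) \<circ> orbit_map (approximant_map T1 (a (Suc k)) d21))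
      (structure_map (\<lambda>n. orbit_map (approximant_map T2 n id)) (b (Suc k)) (b k))" for k
  proof (rule pointed_homotopic_equal[OF pointed_map_compose[OF fp gp] base[OF tilings(2)]])
    fix z assume "z \<in> topspace (approximant_borel H E T2 (b (Suc k)))"
    then obtain S y where S: "S \<in> tiling_hull T2" "z = approximant_orbit H E T2 (b (Suc k)) S y"
      by (rule approximant_borel_pointE)
    then show "(orbit_map (approximant_map T2 (b k) d12) \<circ> orbit_map (approximant_map T1 (a (Suc k)) d21)) z =
        structure_map (\<lambda>n. orbit_map (approximant_map T2 n id)) (b (Suc k)) (b k) z"
      using structure_map_approximant_orbit[OF tilings(2) symmetries_transfer S(1) le(2), where E = E]
        local_derivation.derived_in_hull[OF D21 S(1)] derived_inverse[OF D21 D12 S(1)]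
      by (simp add: gv fv)
  qed
  note sys = pointed_system_approximants[OF tilings(1) H] pointed_system_approximants[OF tilings(2) symmetries_transfer]
  note I = interleaving_pi1_sequence[OF sys ab fp gp fg gf]
  note inv = inverse_system_pi1_sequence[OF sys(1)] inverse_system_pi1_sequence[OF sys(2)]
  show "pro_equivalent (approximant_pro_pi1 H E T1) (approximant_pro_pi1 H E T2)"
    unfolding approximant_pro_pi1_eq by (rule interleaving_imp_pro_equivalent[OF inv I])
  show "inverse_limit (approximant_pro_pi1 H E T1) \<cong> inverse_limit (approximant_pro_pi1 H E T2)"
    unfolding approximant_pro_pi1_eq by (rule interleaving_imp_inverse_limit_iso[OF inv I])
qed

end

theorem theorem5p17:
  fixes T1 :: "('n::finite, 'l1) tiling" and T2 :: "('n, 'l2) tiling"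
    and G1 G2 :: "'n motion set"
    and E :: "'n motion set \<Rightarrow> ('n, 'e) pointed_action_space"
  assumes "CARD('n) \<ge> 2"
    and "is_tiling T1" and "\<not> periodic T1" and "has_point_group T1 G1"
    and "is_tiling T2" and "\<not> periodic T2" and "has_point_group T2 G2"
    and "\<And>H. finite H \<Longrightarrow> subgroup H orthogonal_group \<Longrightarrow> contractible_free_space H (E H)"
    and "S_MLD T1 T2"
  shows "(\<forall>(P1 :: (real \<Rightarrow> 'u) set pro_group) (P2 :: (real \<Rightarrow> 'u) set pro_group).
            is_pro_pi1 (Omega G1 (E G1) T1) (Omega_base G1 (E G1) T1) P1 \<and>
            is_pro_pi1 (Omega G2 (E G2) T2) (Omega_base G2 (E G2) T2) P2 \<longrightarrow>
            pro_equivalent P1 P2 \<and> inverse_limit P1 \<cong> inverse_limit P2) \<and>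
         pro_equivalent (approximant_pro_pi1 G1 (E G1) T1) (approximant_pro_pi1 G2 (E G2) T2) \<and>
         inverse_limit (approximant_pro_pi1 G1 (E G1) T1) \<cong>
           inverse_limit (approximant_pro_pi1 G2 (E G2) T2) \<and>
         (S_MLD_pm T1 G1 T2 G2 \<longrightarrow>
           (let H1 = G_pm T1 G1; H2 = G_pm T2 G2 in
             (\<forall>(P1 :: (real \<Rightarrow> 'u) set pro_group) (P2 :: (real \<Rightarrow> 'u) set pro_group).
                is_pro_pi1 (Omega H1 (E H1) T1) (Omega_base H1 (E H1) T1) P1 \<and>
                is_pro_pi1 (Omega H2 (E H2) T2) (Omega_base H2 (E H2) T2) P2 \<longrightarrow>
                pro_equivalent P1 P2 \<and> inverse_limit P1 \<cong> inverse_limit P2) \<and>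
             pro_equivalent (approximant_pro_pi1 H1 (E H1) T1) (approximant_pro_pi1 H2 (E H2) T2) \<and>
             inverse_limit (approximant_pro_pi1 H1 (E H1) T1) \<cong>
               inverse_limit (approximant_pro_pi1 H2 (E H2) T2)))"
proof -
  note T1 = assms(2) and G1 = assms(4) and T2 = assms(5) and G2 = assms(7)
  \<comment> \<open>All assertions for one pair of groups.\<close>
  define C where "C H1 H2 \<longleftrightarrow>
      (\<forall>(P1 :: (real \<Rightarrow> 'u) set pro_group) (P2 :: (real \<Rightarrow> 'u) set pro_group).
        is_pro_pi1 (Omega H1 (E H1) T1) (Omega_base H1 (E H1) T1) P1 \<and>
        is_pro_pi1 (Omega H2 (E H2) T2) (Omega_base H2 (E H2) T2) P2 \<longrightarrow>
        pro_equivalent P1 P2 \<and> inverse_limit P1 \<cong> inverse_limit P2) \<and>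
      pro_equivalent (approximant_pro_pi1 H1 (E H1) T1) (approximant_pro_pi1 H2 (E H2) T2) \<and>
      inverse_limit (approximant_pro_pi1 H1 (E H1) T1) \<cong>
        inverse_limit (approximant_pro_pi1 H2 (E H2) T2)" for H1 H2
  have C: "C H H" if D: "local_derivation T1 T2 A r1" "local_derivation T2 T1 A r2"
    and H: "H \<subseteq> A" "acts_by_symmetries H T1" "finite H" for A H r1 r2
  proof -
    have "contractible_free_space H (E H)"
      using H(2,3) by (intro assms(8)) (simp_all add: acts_by_symmetries_def)
    note inv = Omega_pro_pi1_invariant[OF D H(1,2) this]
      approximant_pro_pi1_invariant[OF D H(1,2) this]
    show ?thesis
      unfolding C_def by (intro conjI allI impI; (elim conjE)?) (rule inv; assumption)+
  qed
  have acts_iff: "acts_on g T1 \<longleftrightarrow> acts_on g T2"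
    if "local_derivation T1 T2 A r1" "local_derivation T2 T1 A r2" "g \<in> A" for A r1 r2 g
    using local_derivation.acts_on_transfer[OF that(1,3)] local_derivation.acts_on_transfer[OF that(2,3)]
    by blast
  obtain r1 where D12: "local_derivation T1 T2 rotations r1"
    using locally_derivable_imp_local_derivation[OF T1 T2 rotations_subset order_refl] assms(9)
    by (auto simp: S_MLD_def)
  obtain r2 where D21: "local_derivation T2 T1 rotations r2"
    using locally_derivable_imp_local_derivation[OF T2 T1 rotations_subset order_refl] assms(9)
    by (auto simp: S_MLD_def)
  have G: "G1 = G2"
    using acts_iff[OF D12 D21] by (auto simp: point_group_eq[OF T1 G1] point_group_eq[OF T2 G2])
  have "C G1 G2"
    using G1 unfolding G[symmetric]
    by (intro C[OF D12 D21]) (auto simp: has_point_group_def acts_by_symmetries_def)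
  moreover have "C (G_pm T1 G1) (G_pm T2 G2)" if S: "S_MLD_pm T1 G1 T2 G2"
  proof -
    have O: "rotations \<union> G_pm T1 G1 \<subseteq> orthogonal_maps" "rotations \<union> G_pm T2 G2 \<subseteq> orthogonal_maps"
      using rotations_subset by (auto simp: G_pm_eq[OF T1 G1] G_pm_eq[OF T2 G2])
    obtain s1 where D: "local_derivation T1 T2 (rotations \<union> G_pm T1 G1) s1"
      using locally_derivable_imp_local_derivation[OF T1 T2 O(1) Un_upper1] S
      by (auto simp: S_MLD_pm_def)
    obtain s2 where D': "local_derivation T2 T1 (rotations \<union> G_pm T2 G2) s2"
      using locally_derivable_imp_local_derivation[OF T2 T1 O(2) Un_upper1] S
      by (auto simp: S_MLD_pm_def)
    have "G_pm T1 G1 \<subseteq> G_pm T2 G2"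
      using local_derivation.acts_on_transfer[OF D] by (auto simp: G_pm_eq[OF T1 G1] G_pm_eq[OF T2 G2])
    moreover have "G_pm T2 G2 \<subseteq> G_pm T1 G1"
      using local_derivation.acts_on_transfer[OF D'] by (auto simp: G_pm_eq[OF T1 G1] G_pm_eq[OF T2 G2])
    ultimately have eq: "G_pm T1 G1 = G_pm T2 G2" by blast
    have "acts_by_symmetries (G_pm T1 G1) T1"
      using finite_subgroup_G_pm(2)[OF T1 G1]
      by (simp add: acts_by_symmetries_def) (simp add: G_pm_eq[OF T1 G1])
    then show ?thesis
      using finite_subgroup_G_pm(1)[OF T1 G1] D D' unfolding eq by (intro C[OF D[unfolded eq]]) auto
  qed
  ultimately show ?thesis
    unfolding C_def Let_def by (simp only: conj_assoc) blast
qed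

end
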